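(* Let $\gamma(t)$ be a geodesic of $(SPD(n),g_W)$ with $\gamma(0)=A\in SPD(n)$ and $\dot\gamma(0)=X\in T_ASPD(n)$, and let $Y\in T_ASPD(n)$ satisfy $g_W|_A(X,Y)=0$. Then there exists a unique normal Jacobi field $J(t)$ along $\gamma$ with $J(0)=0$ and $\nabla_{\dot\gamma(0)}J=Y$, and it is given by $$J(t)=tY+t^2\left(\Gamma_A[X]\,A\,\Gamma_A[Y]+\Gamma_A[Y]\,A\,\Gamma_A[X]\right).$$
   Context: $SPD(n)$ is the set of real symmetric positive-definite $n\times n$ matrices, an open subset of the space $Sym(n)$ of real symmetric matrices, so $T_ASPD(n)\cong Sym(n)$. For $A\in SPD(n)$ and a real $n\times n$ matrix $X$, $\Gamma_A[X]$ denotes the unique real matrix satisfying $A\,\Gamma_A[X]+\Gamma_A[X]\,A=X$. The Wasserstein metric is the Riemannian metric $g_W|_A(X,Y)=\mathrm{tr}(\Gamma_A[Y]\,A\,\Gamma_A[X])=\frac12\mathrm{tr}(\Gamma_A[Y]X)$ for $X,Y\in T_ASPD(n)$, and $\nabla$ is its Levi-Civita connection; $\nabla_{\dot\gamma(0)}J$ is the covariant derivative of $J$ along $\gamma$ at $t=0$. A Jacobi field along $\gamma$ is normal if it is everywhere $g_W$-orthogonal to $\dot\gamma$. The value $J(t)\in T_{\gamma(t)}SPD(n)$ is identified with a symmetric matrix. *)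

theory Defs
  imports "HOL-Analysis.Analysis"
begin

definition Sym :: "(real^'n^'n) set" where
  "Sym = {A. transpose A = A}"

definition SPD :: "(real^'n^'n) set" where
  "SPD = {A. transpose A = A \<and> (\<forall>x. x \<noteq> 0 \<longrightarrow> x \<bullet> (A *v x) > 0)}"

text \<open>The unique solution \<open>G\<close> of the Sylvester equation \<open>A G + G A = X\<close>, meant for \<open>A \<in> SPD\<close>.\<close>

definition Gam :: "real^'n^'n \<Rightarrow> real^'n^'n \<Rightarrow> real^'n^'n" where
  "Gam A X = (THE G. A ** G + G ** A = X)"

definition gW :: "real^'n^'n \<Rightarrow> real^'n^'n \<Rightarrow> real^'n^'n \<Rightarrow> real" where
  "gW A X Y = trace (Gam A Y ** A ** Gam A X)"


text \<open>
  \<open>SPD\<close> is open in the vector space \<open>Sym\<close>, so every tangent space is \<open>Sym\<close>. Functions and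
  vector fields on \<open>SPD\<close> are total functions of which only the values on \<open>SPD\<close> matter.
  For \<open>A \<in> SPD\<close> and \<open>H \<in> Sym\<close> the line \<open>A + s H\<close> stays in \<open>SPD\<close> for small \<open>s\<close>, so
  the directional derivative below is intrinsic to \<open>SPD\<close>.
\<close>

definition dir_deriv ::
    "(real^'n^'n \<Rightarrow> 'b::real_normed_vector) \<Rightarrow> real^'n^'n \<Rightarrow> real^'n^'n \<Rightarrow> 'b" where
  "dir_deriv f A H = vector_derivative (\<lambda>s. f (A + s *\<^sub>R H)) (at 0)"

primrec C_k_on_SPD :: "nat \<Rightarrow> (real^'n^'n \<Rightarrow> 'b::real_normed_vector) \<Rightarrow> bool" where
  "C_k_on_SPD 0 f \<longleftrightarrow> continuous_on SPD f"
| "C_k_on_SPD (Suc k) f \<longleftrightarrow>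
     f differentiable_on SPD \<and> (\<forall>H\<in>Sym. C_k_on_SPD k (\<lambda>A. dir_deriv f A H))"

definition smooth_on_SPD :: "(real^'n^'n \<Rightarrow> 'b::real_normed_vector) \<Rightarrow> bool" where
  "smooth_on_SPD f \<longleftrightarrow> (\<forall>k. C_k_on_SPD k f)"

definition vector_field :: "(real^'n^'n \<Rightarrow> real^'n^'n) \<Rightarrow> bool" where
  "vector_field U \<longleftrightarrow> (\<forall>A\<in>SPD. U A \<in> Sym) \<and> smooth_on_SPD U"

definition lie_bracket ::
    "(real^'n^'n \<Rightarrow> real^'n^'n) \<Rightarrow> (real^'n^'n \<Rightarrow> real^'n^'n) \<Rightarrow> real^'n^'n \<Rightarrow> real^'n^'n" where
  "lie_bracket U V A = dir_deriv V A (U A) - dir_deriv U A (V A)"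

type_synonym 'n connection =
  "(real^'n^'n \<Rightarrow> real^'n^'n) \<Rightarrow> (real^'n^'n \<Rightarrow> real^'n^'n) \<Rightarrow> real^'n^'n \<Rightarrow> real^'n^'n"

text \<open>The second clause says that \<open>nabla\<close> is well defined on vector fields on \<open>SPD\<close>.\<close>

definition affine_connection :: "'n::finite connection \<Rightarrow> bool" where
  "affine_connection nabla \<longleftrightarrow>
     (\<forall>U V. vector_field U \<longrightarrow> vector_field V \<longrightarrow> vector_field (nabla U V)) \<and>
     (\<forall>U U' V V'. vector_field U \<longrightarrow> vector_field U' \<longrightarrow> vector_field V \<longrightarrow> vector_field V' \<longrightarrow>
        (\<forall>A\<in>SPD. U A = U' A \<and> V A = V' A) \<longrightarrow> (\<forall>A\<in>SPD. nabla U V A = nabla U' V' A)) \<and>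
     (\<forall>U U' V. vector_field U \<longrightarrow> vector_field U' \<longrightarrow> vector_field V \<longrightarrow>
        (\<forall>A\<in>SPD. nabla (\<lambda>B. U B + U' B) V A = nabla U V A + nabla U' V A)) \<and>
     (\<forall>f U V. smooth_on_SPD f \<longrightarrow> vector_field U \<longrightarrow> vector_field V \<longrightarrow>
        (\<forall>A\<in>SPD. nabla (\<lambda>B. f B *\<^sub>R U B) V A = f A *\<^sub>R nabla U V A)) \<and>
     (\<forall>U V V'. vector_field U \<longrightarrow> vector_field V \<longrightarrow> vector_field V' \<longrightarrow>
        (\<forall>A\<in>SPD. nabla U (\<lambda>B. V B + V' B) A = nabla U V A + nabla U V' A)) \<and>
     (\<forall>f U V. smooth_on_SPD f \<longrightarrow> vector_field U \<longrightarrow> vector_field V \<longrightarrow>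
        (\<forall>A\<in>SPD. nabla U (\<lambda>B. f B *\<^sub>R V B) A =
           dir_deriv f A (U A) *\<^sub>R V A + f A *\<^sub>R nabla U V A))"

definition torsion_free :: "'n::finite connection \<Rightarrow> bool" where
  "torsion_free nabla \<longleftrightarrow>
     (\<forall>U V. vector_field U \<longrightarrow> vector_field V \<longrightarrow>
        (\<forall>A\<in>SPD. nabla U V A - nabla V U A = lie_bracket U V A))"

definition gW_compatible :: "'n::finite connection \<Rightarrow> bool" where
  "gW_compatible nabla \<longleftrightarrow>
     (\<forall>U V W. vector_field U \<longrightarrow> vector_field V \<longrightarrow> vector_field W \<longrightarrow>
        (\<forall>A\<in>SPD. dir_deriv (\<lambda>B. gW B (V B) (W B)) A (U A) =
           gW A (nabla U V A) (W A) + gW A (V A) (nabla U W A)))"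

definition levi_civita :: "'n::finite connection \<Rightarrow> bool" where
  "levi_civita nabla \<longleftrightarrow> affine_connection nabla \<and> torsion_free nabla \<and> gW_compatible nabla"

definition curvature_field ::
    "'n::finite connection \<Rightarrow> (real^'n^'n \<Rightarrow> real^'n^'n) \<Rightarrow> (real^'n^'n \<Rightarrow> real^'n^'n) \<Rightarrow>
     (real^'n^'n \<Rightarrow> real^'n^'n) \<Rightarrow> real^'n^'n \<Rightarrow> real^'n^'n" where
  "curvature_field nabla U V W A =
     nabla U (nabla V W) A - nabla V (nabla U W) A - nabla (lie_bracket U V) W A"

text \<open>By tensoriality the curvature at a point may be computed from constant extensions
  of the three tangent vectors.\<close>

definition curvature ::
    "'n::finite connection \<Rightarrow> real^'n^'n \<Rightarrow> real^'n^'n \<Rightarrow> real^'n^'n \<Rightarrow> real^'n^'n \<Rightarrow> real^'n^'n" where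
  "curvature nabla A X Y Z = curvature_field nabla (\<lambda>_. X) (\<lambda>_. Y) (\<lambda>_. Z) A"


text \<open>
  Curves and fields along them are total functions of which only the values on a
  nondegenerate interval \<open>I\<close> matter; at an endpoint belonging to \<open>I\<close>, derivatives are
  one-sided.
\<close>

definition velocity :: "real set \<Rightarrow> (real \<Rightarrow> 'a::real_normed_vector) \<Rightarrow> real \<Rightarrow> 'a" where
  "velocity I c t = vector_derivative c (at t within I)"

definition smooth_on_interval :: "real set \<Rightarrow> (real \<Rightarrow> 'a::real_normed_vector) \<Rightarrow> bool" where
  "smooth_on_interval I c \<longleftrightarrow> (\<forall>k. (velocity I ^^ k) c differentiable_on I)"

text \<open>
  The covariant derivative along \<open>c\<close> of \<open>J = (\<Sum>i. J\<^sub>i E\<^sub>i)\<close>, where the \<open>E\<^sub>i\<close> are the constant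
  vector fields of a basis of \<open>Sym\<close> (a global frame), is
  \<open>(\<Sum>i. J\<^sub>i' E\<^sub>i + J\<^sub>i \<nabla>\<^bsub>c'\<^esub> E\<^sub>i)\<close>.
  Both sums are independent of the basis: the first is the ordinary derivative of \<open>J\<close>, and the
  second is \<open>\<nabla>\<close> of the constant field with value \<open>J t\<close> in direction \<open>c' t\<close>.
\<close>

definition cov_deriv ::
    "'n::finite connection \<Rightarrow> real set \<Rightarrow> (real \<Rightarrow> real^'n^'n) \<Rightarrow> (real \<Rightarrow> real^'n^'n) \<Rightarrow>
     real \<Rightarrow> real^'n^'n" where
  "cov_deriv nabla I c J t = velocity I J t + nabla (\<lambda>_. velocity I c t) (\<lambda>_. J t) (c t)"

definition geodesic :: "'n::finite connection \<Rightarrow> real set \<Rightarrow> (real \<Rightarrow> real^'n^'n) \<Rightarrow> bool" where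
  "geodesic nabla I c \<longleftrightarrow>
     (\<forall>t\<in>I. c t \<in> SPD) \<and> smooth_on_interval I c \<and>
     (\<forall>t\<in>I. cov_deriv nabla I c (velocity I c) t = 0)"

definition jacobi_field ::
    "'n::finite connection \<Rightarrow> real set \<Rightarrow> (real \<Rightarrow> real^'n^'n) \<Rightarrow> (real \<Rightarrow> real^'n^'n) \<Rightarrow> bool" where
  "jacobi_field nabla I c J \<longleftrightarrow>
     (\<forall>t\<in>I. J t \<in> Sym) \<and> smooth_on_interval I J \<and>
     (\<forall>t\<in>I. cov_deriv nabla I c (cov_deriv nabla I c J) t +
        curvature nabla (c t) (J t) (velocity I c t) (velocity I c t) = 0)"

definition normal_jacobi_field ::
    "'n::finite connection \<Rightarrow> real set \<Rightarrow> (real \<Rightarrow> real^'n^'n) \<Rightarrow> (real \<Rightarrow> real^'n^'n) \<Rightarrow> bool" where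
  "normal_jacobi_field nabla I c J \<longleftrightarrow>
     jacobi_field nabla I c J \<and> (\<forall>t\<in>I. gW (c t) (J t) (velocity I c t) = 0)"

end

theory Submission
  imports Defs
begin

text \<open>
  With \<open>x = Gam A X\<close> and \<open>y = Gam A Y\<close>, Koszul's formula gives the Christoffel symbols
  \<open>- (x A y + y A x)\<close>, so along a geodesic \<open>c\<close> the field \<open>x = Gam c c'\<close> satisfies
  \<open>c' = c x + x c\<close>, \<open>c'' = 2 x c x\<close> and hence \<open>x' = - x\<^sup>2\<close>. It follows that \<open>x c x\<close> is constant,
  \<open>c = M A M\<close> with \<open>M = 1 + t x(0)\<close>, and \<open>M\<close> has the inverse \<open>N = 1 - t x\<close>.
  The Jacobi equation is the linearisation of these equations: for
  \<open>w = Gam c (J' - J x - x J)\<close> it says \<open>w' = - (w x + x w)\<close>. So \<open>M w M\<close> is constant, and for two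
  solutions with the same initial data the difference \<open>D\<close> satisfies \<open>D' = D x + x D\<close>, so \<open>N D N\<close>
  is constant, hence zero. Conversely \<open>w = N y N\<close> and \<open>J = t (M A y + y A M)\<close> solve the system.
\<close>

section \<open>The Sylvester equation and the metric\<close>

lemma bounded_bilinear_matrix_mul:
  "bounded_bilinear ((**) :: real^'n^'m \<Rightarrow> real^'p^'n \<Rightarrow> real^'p^'m)"
  unfolding bilinear_conv_bounded_bilinear[symmetric] bilinear_def
  by (auto intro!: linearI
      simp: matrix_matrix_mult_def vec_eq_iff sum.distrib sum_distrib_left algebra_simps)

interpretation matmul: bounded_bilinear "(**) :: real^'n^'n \<Rightarrow> real^'n^'n \<Rightarrow> real^'n^'n"
  by (rule bounded_bilinear_matrix_mul)

lemma bounded_linear_transpose: "bounded_linear (transpose :: real^'n^'m \<Rightarrow> real^'m^'n)"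
  by (auto intro!: linearI simp: linear_conv_bounded_linear[symmetric] transpose_def vec_eq_iff)

lemma bounded_linear_trace: "bounded_linear (trace :: real^'n^'n \<Rightarrow> real)"
  by (auto intro!: linearI
      simp: linear_conv_bounded_linear[symmetric] trace_def sum.distrib sum_distrib_left)

lemmas transpose_linear = bounded_linear.linear[OF bounded_linear_transpose]
lemmas trace_linear = bounded_linear.linear[OF bounded_linear_trace]

lemma trace_transpose: "trace (transpose A) = trace (A :: real^'n^'n)"
  by (simp add: trace_def transpose_def)

text \<open>Expands products over sums and brackets every product to the left, so identities between
  noncommutative words become comparisons of their monomials.\<close>

lemmas mat_simps = matmul.add_left matmul.add_right matmul.diff_left matmul.diff_right
  matmul.minus_left matmul.minus_right matmul.scaleR_left matmul.scaleR_right matrix_mul_assoc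

lemmas tran_simps = linear_add[OF transpose_linear] linear_diff[OF transpose_linear]
  linear_neg[OF transpose_linear] linear_scale[OF transpose_linear] matrix_transpose_mul

lemmas tr_simps = linear_add[OF trace_linear] linear_diff[OF trace_linear]
  linear_neg[OF trace_linear] linear_scale[OF trace_linear]

lemma Sym_iff: "A \<in> Sym \<longleftrightarrow> transpose A = A"
  by (simp add: Sym_def)

lemma SPD_Sym: "A \<in> SPD \<Longrightarrow> transpose A = A"
  by (simp add: SPD_def)

lemma subspace_Sym: "subspace (Sym :: (real^'n^'n) set)"
  by (simp add: subspace_def Sym_iff tran_simps linear_0[OF transpose_linear])

lemma trace_transpose_mul_self: "trace (transpose D ** D) = (norm (D :: real^'n^'n))\<^sup>2"
  apply (simp add: trace_def matrix_matrix_mult_def transpose_def power2_norm_eq_inner inner_vec_def)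
  by (rule sum.swap)

lemma trace_congruence:
  "trace (transpose D ** A ** D) = (\<Sum>j\<in>UNIV. column j D \<bullet> (A *v column j (D :: real^'n^'n)))"
  by (simp add: trace_def matrix_matrix_mult_def transpose_def inner_vec_def matrix_vector_mult_def column_def
      sum_distrib_left sum_distrib_right mult.assoc matrix_mul_assoc[symmetric])
    (rule sum.cong[OF refl sum.swap])

text \<open>The trace sums the quadratic form of \<open>A\<close> over the columns of
  \<open>D\<close>; no summand is negative, and a nonzero column gives a positive one.\<close>

lemma trace_congruence_pos:
  fixes D :: "real^'n^'n"
  assumes A: "A \<in> SPD" and "D \<noteq> 0"
  shows "trace (transpose D ** A ** D) > 0"
proof -
  obtain j where "column j D \<noteq> 0"
    using \<open>D \<noteq> 0\<close> by (auto simp: column_def vec_eq_iff)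
  moreover have "column j D \<bullet> (A *v column j D) \<ge> 0" for j
    using A by (cases "column j D = 0") (auto simp: SPD_def less_imp_le)
  ultimately show ?thesis
    unfolding trace_congruence using A by (intro sum_pos2[of UNIV j]) (auto simp: SPD_def)
qed

text \<open>Multiplying the equation by \<open>transpose G\<close> and taking the trace gives two
  congruence traces, of \<open>G\<close> and of \<open>transpose G\<close>, both positive unless
  \<open>G = 0\<close>.\<close>

lemma sylvester_injective:
  fixes G :: "real^'n^'n"
  assumes A: "A \<in> SPD" and "A ** G + G ** A = 0"
  shows "G = 0"
proof (rule ccontr)
  assume "G \<noteq> 0"
  then have "transpose G \<noteq> 0" by (metis transpose_transpose linear_0[OF transpose_linear])
  have "trace (transpose G ** (A ** G + G ** A)) =
    trace (transpose G ** A ** G) + trace (transpose G ** G ** A)"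
    by (simp add: mat_simps tr_simps)
  also have "trace (transpose G ** G ** A) = trace (transpose (transpose G) ** A ** transpose G)"
    by (metis trace_mul_sym matrix_mul_assoc transpose_transpose)
  finally show False
    using trace_congruence_pos[OF A \<open>G \<noteq> 0\<close>] trace_congruence_pos[OF A \<open>transpose G \<noteq> 0\<close>]
      assms(2) by simp (simp add: trace_def)
qed

text \<open>The Sylvester operator is an injective endomorphism of a finite-dimensional space, hence
  bijective.\<close>

lemma sylvester_ex1:
  fixes X :: "real^'n^'n"
  assumes "A \<in> SPD"
  shows "\<exists>!G. A ** G + G ** A = X"
proof -
  let ?L = "\<lambda>G. A ** G + G ** A"
  have lin: "linear ?L"
    by (auto intro!: linearI simp: mat_simps algebra_simps)
  have "inj ?L"
    unfolding linear_injective_0[OF lin] using sylvester_injective[OF assms] by blast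
  moreover obtain G where "?L G = X"
    using surjD[OF linear_injective_imp_surjective[OF lin \<open>inj ?L\<close>], of X] by auto
  ultimately show ?thesis
    by (intro ex1I[of _ G]) (assumption, erule injD, simp only:)
qed

lemma Gam_eq: "A \<in> SPD \<Longrightarrow> A ** Gam A X + Gam A X ** A = X"
  unfolding Gam_def by (rule theI'[OF sylvester_ex1])

lemma Gam_unique: "A \<in> SPD \<Longrightarrow> A ** G + G ** A = X \<Longrightarrow> Gam A X = G"
  unfolding Gam_def by (rule the1_equality[OF sylvester_ex1])

lemma linear_Gam:
  assumes "A \<in> SPD" shows "linear (Gam A)"
proof (intro linearI Gam_unique[OF assms])
  show "A ** (Gam A X + Gam A Y) + (Gam A X + Gam A Y) ** A = X + Y" for X Y
    using arg_cong2[OF Gam_eq[OF assms, of X] Gam_eq[OF assms, of Y], of "(+)"]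
    by (simp add: matmul.add_left matmul.add_right ac_simps)
  show "A ** (r *\<^sub>R Gam A X) + (r *\<^sub>R Gam A X) ** A = r *\<^sub>R X" for r X
    using arg_cong[OF Gam_eq[OF assms, of X], of "scaleR r"]
    by (simp only: matmul.scaleR_left matmul.scaleR_right scaleR_add_right)
qed

lemma bounded_linear_Gam: "A \<in> SPD \<Longrightarrow> bounded_linear (Gam A)"
  using linear_Gam linear_conv_bounded_linear by blast

text \<open>Transposing the Sylvester equation shows that the transposed solution solves it too, so
  uniqueness applies.\<close>

lemma Gam_Sym:
  assumes A: "A \<in> SPD" and X: "X \<in> Sym"
  shows "transpose (Gam A X) = Gam A X"
proof (rule Gam_unique[OF A, symmetric])
  have "transpose (A ** Gam A X + Gam A X ** A) = transpose X"
    using A by (simp add: Gam_eq)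
  then show "A ** transpose (Gam A X) + transpose (Gam A X) ** A = X"
    using A X by (simp add: tran_simps SPD_Sym Sym_iff add.commute)
qed

text \<open>By cyclicity the Sylvester operator is self-adjoint for the pairing
  \<open>trace (X ** Y)\<close>, and so is its inverse.\<close>

lemma Gam_trace_self_adjoint:
  assumes "A \<in> SPD" shows "trace (Gam A X ** Y) = trace (X ** Gam A Y)"
proof -
  have "trace (Gam A X ** (A ** Gam A Y + Gam A Y ** A)) =
      trace ((A ** Gam A X + Gam A X ** A) ** Gam A Y)"
    using trace_mul_sym[of "Gam A X ** Gam A Y" A] by (simp add: mat_simps tr_simps)
  then show ?thesis using assms by (simp add: Gam_eq)
qed

text \<open>Splitting \<open>X\<close> by its Sylvester equation gives two traces; transposition and
  cyclicity make them equal.\<close>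

lemma gW_eq_half_trace:
  assumes A: "A \<in> SPD" and X: "X \<in> Sym" and Y: "Y \<in> Sym"
  shows "gW A X Y = trace (Gam A Y ** X) / 2"
proof -
  let ?x = "Gam A X" and ?y = "Gam A Y"
  have "trace (?y ** ?x ** A) = trace (transpose (?y ** ?x ** A))"
    by (simp only: trace_transpose)
  also have "\<dots> = trace (A ** ?x ** ?y)"
    using assms by (simp add: tran_simps Gam_Sym SPD_Sym matrix_mul_assoc)
  also have "\<dots> = trace (?y ** A ** ?x)"
    by (metis trace_mul_sym matrix_mul_assoc)
  finally have "trace (?y ** (A ** ?x + ?x ** A)) = 2 * trace (?y ** A ** ?x)"
    by (simp add: mat_simps tr_simps)
  then show ?thesis using A by (simp add: Gam_eq gW_def)
qed

lemma gW_nondegenerate: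
  assumes A: "A \<in> SPD" and D: "D \<in> Sym" and 0: "\<And>Z. Z \<in> Sym \<Longrightarrow> gW A D Z = 0"
  shows "D = 0"
proof -
  \<comment> \<open>The test vector is the Sylvester image of \<open>D\<close>: its
    \<open>Gam\<close> is \<open>D\<close> itself, so the pairing becomes half the squared norm of
    \<open>D\<close>.\<close>
  have "A ** D + D ** A \<in> Sym"
    using A D by (simp add: Sym_iff tran_simps SPD_Sym add.commute)
  moreover have "Gam A (A ** D + D ** A) = D"
    using A by (rule Gam_unique) simp
  ultimately have "trace (transpose D ** D) = 0"
    using 0[of "A ** D + D ** A"] A D by (simp add: gW_eq_half_trace Sym_iff)
  then show ?thesis by (simp add: trace_transpose_mul_self)
qed

section \<open>Differentiating the solution of the Sylvester equation\<close>

lemma has_vector_derivative_iff_quotient: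
  "(f has_vector_derivative D) (at x within S) \<longleftrightarrow>
    ((\<lambda>y. (f y - f x) /\<^sub>R (y - x)) \<longlongrightarrow> D) (at x within S)"
proof -
  have "(f has_vector_derivative D) (at x within S) \<longleftrightarrow>
    ((\<lambda>y. norm (f y - f x - (y - x) *\<^sub>R D) / norm (y - x)) \<longlongrightarrow> 0) (at x within S)"
    by (simp add: has_vector_derivative_def has_derivative_iff_norm bounded_linear_scaleR_left)
  also have "\<dots> \<longleftrightarrow> ((\<lambda>y. norm ((f y - f x) /\<^sub>R (y - x) - D)) \<longlongrightarrow> 0) (at x within S)"
  proof (rule tendsto_cong)
    have "norm (f y - f x - (y - x) *\<^sub>R D) / norm (y - x) = norm ((f y - f x) /\<^sub>R (y - x) - D)"
      if "y \<noteq> x" for y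
    proof -
      have "(f y - f x) /\<^sub>R (y - x) - D = (f y - f x - (y - x) *\<^sub>R D) /\<^sub>R (y - x)"
        using that by (simp add: scaleR_diff_right)
      then show ?thesis by (simp add: divide_inverse mult.commute)
    qed
    then show "\<forall>\<^sub>F y in at x within S. norm (f y - f x - (y - x) *\<^sub>R D) / norm (y - x) =
        norm ((f y - f x) /\<^sub>R (y - x) - D)"
      by (simp add: eventually_at_filter)
  qed
  finally show ?thesis by (simp add: tendsto_norm_zero_iff flip: LIM_zero_iff[of f])
     (simp add: LIM_zero_iff tendsto_norm_zero_iff)
qed

text \<open>A solution at \<open>A\<close> is read as a solution at \<open>B\<close> with a changed
  right-hand side, so that the operator to be inverted can stay fixed while the base point
  moves.\<close>

lemma sylvester_perturb:
  fixes A B G Z :: "real^'n^'n"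
  assumes "A ** G + G ** A = Z"
  shows "B ** G + G ** B = Z - (A - B) ** G - G ** (A - B)"
  using assms by (auto simp: matmul.diff_left matmul.diff_right)

text \<open>Formally, differentiate \<open>c G + G c = Z\<close> and solve for the derivative of
  \<open>G\<close>. Rigorously, everything is expressed through the fixed map
  \<open>Gam (c t)\<close>: first local boundedness, then continuity, then the difference
  quotient.\<close>

lemma has_vector_derivative_Gam:
  fixes c Z :: "real \<Rightarrow> real^'n^'n"
  assumes c: "(c has_vector_derivative c') (at t within S)"
    and Z: "(Z has_vector_derivative Z') (at t within S)"
    and ct: "c t \<in> SPD" and ev: "\<forall>\<^sub>F s in at t within S. c s \<in> SPD"
  defines "G \<equiv> Gam (c t) (Z t)"
  shows "((\<lambda>s. Gam (c s) (Z s)) has_vector_derivative Gam (c t) (Z' - c' ** G - G ** c'))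
    (at t within S)"
proof -
  let ?F = "at t within S"
  let ?g = "\<lambda>s. Gam (c s) (Z s)"
  interpret S: bounded_linear "Gam (c t)"
    by (rule bounded_linear_Gam[OF ct])
  have c_tendsto: "(c \<longlongrightarrow> c t) ?F" and Z_tendsto: "(Z \<longlongrightarrow> Z t) ?F"
    using has_vector_derivative_continuous[OF c] has_vector_derivative_continuous[OF Z]
    by (simp_all add: continuous_within)
  have perturb: "?g s = Gam (c t) (Z s - (c s - c t) ** ?g s - ?g s ** (c s - c t))"
    if "c s \<in> SPD" for s
    by (intro Gam_unique[OF ct, symmetric] sylvester_perturb Gam_eq that)
  have Bg: "Bfun ?g ?F"
  proof -
    obtain K where K: "K > 0" "\<And>P. norm (Gam (c t) P) \<le> norm P * K"
      using S.pos_bounded by blast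
    obtain \<kappa> where \<kappa>: "\<kappa> > 0" "\<And>(P :: real^'n^'n) (Q :: real^'n^'n). norm (P ** Q) \<le> norm P * norm Q * \<kappa>"
      using matmul.pos_bounded by blast
    \<comment> \<open>With the radius \<open>1 / (4 * K * \<kappa>)\<close> the two perturbation
      terms contribute at most half of \<open>norm (?g s)\<close>, which is absorbed on the
      left.\<close>
    have "\<forall>\<^sub>F s in ?F. norm (c s - c t) < 1 / (4 * K * \<kappa>)"
      using tendstoD[OF c_tendsto, of "1 / (4 * K * \<kappa>)"] K(1) \<kappa>(1) by (simp add: dist_norm)
    moreover have "\<forall>\<^sub>F s in ?F. norm (Z s - Z t) < 1"
      using tendstoD[OF Z_tendsto, of 1] by (simp add: dist_norm)
    ultimately have "\<forall>\<^sub>F s in ?F. norm (?g s) \<le> 2 * K * (norm (Z t) + 1)"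
      using ev
    proof eventually_elim
      case (elim s)
      let ?d = "norm (c s - c t)" and ?n = "norm (?g s)"
      have "?n \<le> norm (Z s - (c s - c t) ** ?g s - ?g s ** (c s - c t)) * K"
        using K(2) perturb[OF elim(3)] by metis
      also have "norm (Z s - (c s - c t) ** ?g s - ?g s ** (c s - c t)) \<le>
          norm (Z s) + norm ((c s - c t) ** ?g s) + norm (?g s ** (c s - c t))"
        by (rule order_trans[OF norm_triangle_ineq4])
          (intro add_mono order_refl norm_triangle_ineq4)
      also have "\<dots> \<le> (norm (Z t) + 1) + ?d * ?n * \<kappa> + ?n * ?d * \<kappa>"
        using elim(2) norm_triangle_sub[of "Z s" "Z t"] by (intro add_mono \<kappa>(2)) simp
      also have "\<dots> = (norm (Z t) + 1) + 2 * \<kappa> * ?n * ?d"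
        by simp
      also have "\<dots> \<le> (norm (Z t) + 1) + 2 * \<kappa> * ?n * (1 / (4 * K * \<kappa>))"
        using elim(1) \<kappa>(1) by (intro add_left_mono mult_left_mono) auto
      also have "\<dots> * K = K * (norm (Z t) + 1) + ?n / 2"
        using \<kappa>(1) K(1) by (simp add: field_simps)
      finally show ?case using K(1) by simp
    qed
    then show ?thesis by (rule BfunI)
  qed
  have c0: "Zfun (\<lambda>s. c s - c t) ?F"
    using c_tendsto by (simp add: tendsto_Zfun_iff)
  \<comment> \<open>A factor tending to zero times a bounded one tends to zero, so boundedness of
    \<open>?g\<close> already yields its continuity at \<open>t\<close>.\<close>
  have "((\<lambda>s. Z s - (c s - c t) ** ?g s - ?g s ** (c s - c t)) \<longlongrightarrow> Z t - 0 - 0) ?F"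
    using matmul.Zfun_prod_Bfun[OF c0 Bg] matmul.Bfun_prod_Zfun[OF Bg c0]
    by (intro tendsto_diff Z_tendsto) (simp_all add: tendsto_Zfun_iff)
  then have "((\<lambda>s. Gam (c t) (Z s - (c s - c t) ** ?g s - ?g s ** (c s - c t))) \<longlongrightarrow>
      Gam (c t) (Z t - 0 - 0)) ?F"
    by (rule S.tendsto)
  then have g_tendsto: "(?g \<longlongrightarrow> G) ?F"
    unfolding G_def diff_zero
    by (rule Lim_transform_eventually) (use ev perturb in \<open>auto elim!: eventually_mono\<close>)
  \<comment> \<open>Both \<open>?g s\<close> and \<open>?g t\<close> are now values of the same
    linear map, so the difference quotient passes to its argument.\<close>
  have quotient: "Gam (c t) ((Z s - Z t) /\<^sub>R (s - t) - ((c s - c t) /\<^sub>R (s - t)) ** ?g s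
      - ?g s ** ((c s - c t) /\<^sub>R (s - t))) = (?g s - ?g t) /\<^sub>R (s - t)" if "c s \<in> SPD" for s
  proof -
    have "?g s - ?g t = Gam (c t) (Z s - (c s - c t) ** ?g s - ?g s ** (c s - c t)) - ?g t"
      by (simp only: perturb[OF that, symmetric])
    also have "\<dots> = Gam (c t) (Z s - Z t - (c s - c t) ** ?g s - ?g s ** (c s - c t))"
      by (simp only: S.diff) simp
    also have "\<dots> /\<^sub>R (s - t) =
        Gam (c t) ((Z s - Z t - (c s - c t) ** ?g s - ?g s ** (c s - c t)) /\<^sub>R (s - t))"
      by (simp add: S.scaleR)
    finally show ?thesis
      by (simp add: scaleR_diff_right matmul.scaleR_left matmul.scaleR_right
          matmul.diff_left matmul.diff_right)
  qed
  show ?thesis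
    unfolding has_vector_derivative_iff_quotient
  proof (rule Lim_transform_eventually)
    show "((\<lambda>s. Gam (c t) ((Z s - Z t) /\<^sub>R (s - t) - ((c s - c t) /\<^sub>R (s - t)) ** ?g s
      - ?g s ** ((c s - c t) /\<^sub>R (s - t)))) \<longlongrightarrow> Gam (c t) (Z' - c' ** G - G ** c')) ?F"
      using c Z g_tendsto unfolding has_vector_derivative_iff_quotient
      by (intro S.tendsto tendsto_diff matmul.tendsto)
    show "\<forall>\<^sub>F s in ?F. Gam (c t) ((Z s - Z t) /\<^sub>R (s - t) - ((c s - c t) /\<^sub>R (s - t)) ** ?g s
      - ?g s ** ((c s - c t) /\<^sub>R (s - t))) = (?g s - ?g t) /\<^sub>R (s - t)"
      using ev quotient by (auto elim!: eventually_mono)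
  qed
qed

section \<open>Openness of \<open>SPD\<close> in \<open>Sym\<close> and directional
  derivatives\<close>

lemma SPD_coercive:
  fixes A :: "real^'n^'n"
  assumes "A \<in> SPD"
  obtains m where "m > 0" "\<And>x. x \<bullet> (A *v x) \<ge> m * (norm x)\<^sup>2"
proof -
  \<comment> \<open>The constant is the minimum of the quadratic form on the compact unit sphere;
    homogeneity extends the bound to all vectors.\<close>
  have "continuous_on (sphere 0 1) (\<lambda>x. x \<bullet> (A *v x))"
    by (intro continuous_intros linear_continuous_on matrix_vector_mul_bounded_linear)
  moreover have "sphere (0 :: real^'n) 1 \<noteq> {}"
    by simp
  ultimately obtain u where u: "u \<in> sphere 0 1"
    and le: "\<And>x. x \<in> sphere 0 1 \<Longrightarrow> u \<bullet> (A *v u) \<le> x \<bullet> (A *v x)"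
    using continuous_attains_inf[OF compact_sphere] by (metis (no_types, lifting))
  have "u \<bullet> (A *v u) > 0"
  proof -
    have "u \<noteq> 0" using u by auto
    then show ?thesis using assms by (auto simp: SPD_def)
  qed
  moreover have "x \<bullet> (A *v x) \<ge> u \<bullet> (A *v u) * (norm x)\<^sup>2" for x
  proof (cases "x = 0")
    case False
    then have "u \<bullet> (A *v u) \<le> (x /\<^sub>R norm x) \<bullet> (A *v (x /\<^sub>R norm x))"
      by (intro le) simp
    also have "\<dots> = x \<bullet> (A *v x) / (norm x)\<^sup>2"
      by (simp add: matrix_vector_mult_scaleR power2_eq_square divide_inverse)
    finally show ?thesis using False by (simp add: field_simps)
  qed simp
  ultimately show ?thesis by (rule that)
qed

text \<open>The form of \<open>s *\<^sub>R H\<close> is at most \<open>\<bar>s\<bar> * K\<close>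
  times the squared norm, which stays below the coercivity bound \<open>m\<close> when
  \<open>\<bar>s\<bar> < m / K\<close>.\<close>

lemma eventually_line_SPD:
  fixes A H :: "real^'n^'n"
  assumes A: "A \<in> SPD" and H: "H \<in> Sym"
  shows "\<forall>\<^sub>F s in at 0. A + s *\<^sub>R H \<in> SPD"
proof -
  obtain m where m: "m > 0" "\<And>x. x \<bullet> (A *v x) \<ge> m * (norm x)\<^sup>2"
    using SPD_coercive[OF A] by blast
  obtain K where K: "K > 0" "\<And>x. norm (H *v x) \<le> norm x * K"
    using bounded_linear.pos_bounded[OF matrix_vector_mul_bounded_linear[of H]] by blast
  have "\<forall>\<^sub>F s in at (0::real). \<bar>s\<bar> < m / K"
    using tendstoD[OF tendsto_ident_at, of "m / K" "0::real" UNIV] m K by (simp add: dist_real_def)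
  then show ?thesis
  proof eventually_elim
    case (elim s)
    have "x \<bullet> ((A + s *\<^sub>R H) *v x) > 0" if "x \<noteq> 0" for x
    proof -
      have "\<bar>x \<bullet> (H *v x)\<bar> \<le> norm x * (norm x * K)"
        by (rule order_trans[OF Cauchy_Schwarz_ineq2]) (intro mult_left_mono K(2) norm_ge_zero)
      then have "\<bar>s * (x \<bullet> (H *v x))\<bar> \<le> \<bar>s\<bar> * (K * (norm x)\<^sup>2)"
        unfolding abs_mult
        by (intro mult_left_mono) (simp_all add: power2_eq_square ac_simps)
      also have "\<dots> < m / K * (K * (norm x)\<^sup>2)"
        using elim that K(1) by (intro mult_strict_right_mono) auto
      also have "\<dots> = m * (norm x)\<^sup>2"
        using K(1) by simp
      also have "\<dots> \<le> x \<bullet> (A *v x)"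
        by (rule m(2))
      finally show ?thesis
        by (simp add: matrix_vector_mult_add_rdistrib inner_add_right abs_less_iff
            flip: scaleR_matrix_vector_assoc)
    qed
    moreover have "transpose (A + s *\<^sub>R H) = A + s *\<^sub>R H"
      using A H by (simp add: tran_simps SPD_Sym Sym_iff)
    ultimately show ?case by (simp add: SPD_def)
  qed
qed

lemma has_vector_derivative_line: "((\<lambda>s. A + s *\<^sub>R H) has_vector_derivative H) (at x within S)"
  by (auto intro!: derivative_eq_intros)

lemma C_k_on_SPD_const: "C_k_on_SPD k (\<lambda>_ :: real^'n^'n. Z :: 'b::real_normed_vector)"
proof (induction k arbitrary: Z)
  case (Suc k)
  have "dir_deriv (\<lambda>_. Z) = (\<lambda>(A :: real^'n^'n) H. 0)"
    by (simp add: dir_deriv_def fun_eq_iff)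
  with Suc.IH[of 0] show ?case by simp
qed (simp add: continuous_on_const)

lemma vector_field_const: "Z \<in> Sym \<Longrightarrow> vector_field (\<lambda>_. Z)"
  by (simp add: vector_field_def smooth_on_SPD_def C_k_on_SPD_const)

lemma vector_field_dir_deriv:
  fixes V :: "real^'n^'n \<Rightarrow> real^'n^'n"
  assumes V: "vector_field V" and A: "A \<in> SPD" and H: "H \<in> Sym"
  shows "((\<lambda>s. V (A + s *\<^sub>R H)) has_vector_derivative dir_deriv V A H) (at 0)"
proof -
  let ?S = "{s. A + s *\<^sub>R H \<in> SPD}"
  have "V differentiable_on SPD"
    using V by (auto simp: vector_field_def smooth_on_SPD_def dest: spec[of _ 1])
  then obtain D where D: "(V has_derivative D) (at (A + 0 *\<^sub>R H) within SPD)"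
    using A by (auto simp: differentiable_on_def differentiable_def)
  have "((V \<circ> (\<lambda>s. A + s *\<^sub>R H)) has_vector_derivative D H) (at 0 within ?S)"
    by (rule vector_derivative_diff_chain_within[OF has_vector_derivative_line])
      (rule has_derivative_subset[OF D], auto)
  \<comment> \<open>Differentiability is given only within \<open>SPD\<close>; since the line stays
    in \<open>SPD\<close> near 0, the restriction on \<open>s\<close> disappears.\<close>
  moreover have "at 0 within ?S = at (0::real)"
    using eventually_line_SPD[OF A H]
    by (simp add: filter_eq_iff eventually_at_filter) (auto elim: eventually_elim2)
  ultimately have "((\<lambda>s. V (A + s *\<^sub>R H)) has_vector_derivative D H) (at 0)"
    by (simp add: o_def)
  then show ?thesis
    unfolding dir_deriv_def by (metis vector_derivative_at)
qed

section \<open>The Levi-Civita connection\<close>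

text \<open>The Christoffel symbols of \<open>gW\<close> in the global chart \<open>Sym\<close>, as
  \<open>levi_civita_const\<close> confirms.\<close>

definition Chr :: "real^'n^'n \<Rightarrow> real^'n^'n \<Rightarrow> real^'n^'n \<Rightarrow> real^'n^'n" where
  "Chr A X Y = - (Gam A X ** A ** Gam A Y + Gam A Y ** A ** Gam A X)"

text \<open>The derivative of \<open>Chr\<close> in the base point, from \<open>D(Gam A X)[H] = - Gam A (H x + x H)\<close>.\<close>

definition DChr :: "real^'n^'n \<Rightarrow> real^'n^'n \<Rightarrow> real^'n^'n \<Rightarrow> real^'n^'n \<Rightarrow> real^'n^'n" where
  "DChr A H X Y = (let x = Gam A X; y = Gam A Y; x' = Gam A (H ** x + x ** H); y' = Gam A (H ** y + y ** H)
     in x' ** A ** y + x ** A ** y' + y' ** A ** x + y ** A ** x' - x ** H ** y - y ** H ** x)"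

lemma Chr_commute: "Chr A X Y = Chr A Y X"
  by (simp add: Chr_def)

lemma DChr_commute: "DChr A H X Y = DChr A H Y X"
  by (simp add: DChr_def Let_def algebra_simps)

lemma Chr_Sym: "A \<in> SPD \<Longrightarrow> X \<in> Sym \<Longrightarrow> Y \<in> Sym \<Longrightarrow> Chr A X Y \<in> Sym"
  by (simp add: Chr_def Sym_iff tran_simps Gam_Sym[unfolded Sym_iff] SPD_Sym matrix_mul_assoc)

lemma linear_Chr:
  assumes "A \<in> SPD" shows "linear (Chr A X)"
  by (intro linearI)
    (simp_all add: Chr_def linear_add[OF linear_Gam[OF assms]] linear_scale[OF linear_Gam[OF assms]]
      mat_simps scaleR_diff_right)

lemma has_vector_derivative_Chr:
  fixes c U V :: "real \<Rightarrow> real^'n^'n"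
  assumes c: "(c has_vector_derivative c') (at t within S)"
    and U: "(U has_vector_derivative U') (at t within S)"
    and V: "(V has_vector_derivative V') (at t within S)"
    and ct: "c t \<in> SPD" and ev: "\<forall>\<^sub>F s in at t within S. c s \<in> SPD"
  shows "((\<lambda>s. Chr (c s) (U s) (V s)) has_vector_derivative
    DChr (c t) c' (U t) (V t) + Chr (c t) U' (V t) + Chr (c t) (U t) V') (at t within S)"
proof -
  note gam = has_vector_derivative_Gam[OF c _ ct ev]
  note mul = matmul.has_vector_derivative
  note diff = linear_diff[OF linear_Gam[OF ct]] and add = linear_add[OF linear_Gam[OF ct]]
  show ?thesis
    unfolding Chr_def
    by (rule has_vector_derivative_eq_rhs,
        rule has_vector_derivative_minus[OF has_vector_derivative_add[OF
          mul[OF mul[OF gam[OF U] c] gam[OF V]] mul[OF mul[OF gam[OF V] c] gam[OF U]]]])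
      (simp add: DChr_def Let_def diff add mat_simps)
qed

text \<open>\<open>Sym\<close> is a closed subspace, so it contains the limits of its difference
  quotients.\<close>

lemma has_vector_derivative_Sym:
  fixes f :: "real \<Rightarrow> real^'n^'n"
  assumes "(f has_vector_derivative D) (at t within S)" and "at t within S \<noteq> bot"
    and "\<forall>\<^sub>F s in at t within S. f s \<in> Sym" and "f t \<in> Sym"
  shows "D \<in> Sym"
proof (rule Lim_in_closed_set)
  show "closed (Sym :: (real^'n^'n) set)"
    by (rule closed_subspace[OF subspace_Sym])
  show "((\<lambda>s. (f s - f t) /\<^sub>R (s - t)) \<longlongrightarrow> D) (at t within S)"
    using assms(1) by (simp add: has_vector_derivative_iff_quotient)
  show "\<forall>\<^sub>F s in at t within S. (f s - f t) /\<^sub>R (s - t) \<in> Sym"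
    using assms(3)
    by eventually_elim (intro subspace_scale subspace_diff subspace_Sym assms(4))
qed (fact assms(2))

lemma dir_deriv_Sym:
  assumes V: "vector_field V" and A: "A \<in> SPD" and H: "H \<in> Sym"
  shows "dir_deriv V A H \<in> Sym"
proof (rule has_vector_derivative_Sym[OF vector_field_dir_deriv[OF assms]])
  show "\<forall>\<^sub>F s in at 0. V (A + s *\<^sub>R H) \<in> Sym"
    using eventually_line_SPD[OF A H] by eventually_elim (use V in \<open>simp add: vector_field_def\<close>)
  show "V (A + 0 *\<^sub>R H) \<in> Sym"
    using V A by (simp add: vector_field_def)
qed simp

text \<open>Lets the metric and the connection be replaced, before differentiating, by closed
  formulas that hold only on \<open>SPD\<close>.\<close>

lemma dir_deriv_eqI:
  assumes "A \<in> SPD" and "H \<in> Sym"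
    and eq: "\<And>B. B \<in> SPD \<Longrightarrow> f B = g B"
    and g: "((\<lambda>s. g (A + s *\<^sub>R H)) has_vector_derivative D) (at 0)"
  shows "dir_deriv f A H = D"
  unfolding dir_deriv_def
proof (rule vector_derivative_at)
  have "\<forall>\<^sub>F s in nhds 0. A + s *\<^sub>R H \<in> SPD"
    using eventually_line_SPD[OF assms(1,2)] assms(1) by (auto simp: eventually_nhds_conv_at)
  then have "\<forall>\<^sub>F s in nhds 0. s \<in> UNIV \<longrightarrow> g (A + s *\<^sub>R H) = f (A + s *\<^sub>R H)"
    by eventually_elim (simp add: eq)
  then show "((\<lambda>s. f (A + s *\<^sub>R H)) has_vector_derivative D) (at 0)"
    by (rule iffD1[OF has_vector_derivative_cong_ev, OF _ _ g]) (simp add: eq assms(1))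
qed

section \<open>The derivative of the metric and the determination of the connection\<close>

lemma gW_commute:
  assumes "A \<in> SPD" and "X \<in> Sym" and "Y \<in> Sym"
  shows "gW A X Y = gW A Y X"
proof -
  have "trace (Gam A Y ** A ** Gam A X) = trace (transpose (Gam A Y ** A ** Gam A X))"
    by (simp only: trace_transpose)
  then show ?thesis
    using assms by (simp add: gW_def tran_simps Gam_Sym SPD_Sym matrix_mul_assoc)
qed

lemma gW_diff_left: "A \<in> SPD \<Longrightarrow> gW A (X - X') Y = gW A X Y - gW A X' Y"
  by (simp add: gW_def linear_diff[OF linear_Gam] mat_simps tr_simps)

text \<open>In the half-trace form the base point enters through \<open>Gam B Z\<close> and
  \<open>V B\<close> only. Differentiating \<open>Gam B Z\<close> leaves a \<open>Gam A\<close>,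
  which self-adjointness moves onto \<open>V A\<close>; the two resulting traces agree by
  transposition.\<close>

lemma dir_deriv_gW:
  fixes V :: "real^'n^'n \<Rightarrow> real^'n^'n"
  assumes V: "vector_field V" and A: "A \<in> SPD" and X: "X \<in> Sym" and Z: "Z \<in> Sym"
  shows "dir_deriv (\<lambda>B. gW B (V B) Z) A X =
    gW A (dir_deriv V A X) Z - trace (X ** Gam A Z ** Gam A (V A))"
proof (rule dir_deriv_eqI[OF A X])
  fix B :: "real^'n^'n" assume "B \<in> SPD"
  then show "gW B (V B) Z = trace (Gam B Z ** V B) / 2"
    using V Z by (simp add: gW_eq_half_trace vector_field_def)
next
  let ?z = "Gam A Z" and ?v = "Gam A (V A)"
  have VA: "V A \<in> Sym" using V A by (simp add: vector_field_def)
  have 1: "((\<lambda>s. Gam (A + s *\<^sub>R X) Z) has_vector_derivative Gam A (- (X ** ?z) - ?z ** X)) (at 0)"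
    using has_vector_derivative_Gam[OF has_vector_derivative_line[of A X] has_vector_derivative_const[of Z], of 0 UNIV]
      eventually_line_SPD[OF A X] A by simp
  have "((\<lambda>s. trace (Gam (A + s *\<^sub>R X) Z ** V (A + s *\<^sub>R X)) / 2) has_vector_derivative
      trace (?z ** dir_deriv V A X + Gam A (- (X ** ?z) - ?z ** X) ** V A) / 2) (at 0)"
    using bounded_linear.has_vector_derivative[OF bounded_linear_divide
        bounded_linear.has_vector_derivative[OF bounded_linear_trace
          matmul.has_vector_derivative[OF 1 vector_field_dir_deriv[OF V A X]]], of 2]
    by simp
  moreover have "trace (Gam A (- (X ** ?z) - ?z ** X) ** V A) = - 2 * trace (X ** ?z ** ?v)"
  proof -
    have "trace (?z ** X ** ?v) = trace (transpose (?z ** X ** ?v))"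
      by (simp only: trace_transpose)
    also have "\<dots> = trace (?v ** (X ** ?z))"
      using A X Z VA by (simp add: tran_simps Gam_Sym Sym_iff[symmetric] matrix_mul_assoc)
         (simp add: Sym_iff)
    also have "\<dots> = trace (X ** ?z ** ?v)"
      by (rule trace_mul_sym)
    finally show ?thesis
      using A by (simp add: Gam_trace_self_adjoint mat_simps tr_simps)
  qed
  moreover have "trace (?z ** dir_deriv V A X) = 2 * gW A (dir_deriv V A X) Z"
    using A Z dir_deriv_Sym[OF V A X] by (simp add: gW_eq_half_trace)
  ultimately show "((\<lambda>s. trace (Gam (A + s *\<^sub>R X) Z ** V (A + s *\<^sub>R X)) / 2) has_vector_derivative
      gW A (dir_deriv V A X) Z - trace (X ** ?z ** ?v)) (at 0)"
    by (simp only: tr_simps) (simp add: diff_divide_distrib)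
qed

text \<open>The right-hand side is the Koszul combination of derivatives of the metric on constant
  fields. Once \<open>X\<close>, \<open>Y\<close>, \<open>Z\<close> are expanded, both sides are
  traces of words in \<open>A\<close>, \<open>x\<close>, \<open>y\<close>, \<open>z\<close>, which
  match up to rotation and reversal.\<close>

lemma gW_Chr:
  assumes A: "A \<in> SPD" and X: "X \<in> Sym" and Y: "Y \<in> Sym" and Z: "Z \<in> Sym"
  shows "2 * gW A (Chr A X Y) Z = trace (Z ** Gam A Y ** Gam A X)
    - trace (X ** Gam A Z ** Gam A Y) - trace (Y ** Gam A Z ** Gam A X)"
proof -
  define x y z where xyz: "x = Gam A X" "y = Gam A Y" "z = Gam A Z"
  have sym: "transpose x = x" "transpose y = y" "transpose z = z" "transpose A = A"
    unfolding xyz using A X Y Z by (simp_all add: Gam_Sym SPD_Sym)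
  have syl: "X = A ** x + x ** A" "Y = A ** y + y ** A" "Z = A ** z + z ** A"
    unfolding xyz using A by (simp_all add: Gam_eq)
  have flip: "trace (A ** a ** b ** c) = trace (A ** c ** b ** a)"
    if "transpose a = a" "transpose b = b" "transpose c = c" for a b c
  proof -
    have "trace (A ** a ** b ** c) = trace (transpose (A ** a ** b ** c))"
      by (simp only: trace_transpose)
    also have "\<dots> = trace ((c ** b ** a) ** A)"
      using that sym by (simp add: tran_simps matrix_mul_assoc)
    also have "\<dots> = trace (A ** c ** b ** a)"
      by (subst trace_mul_sym) (simp add: matrix_mul_assoc)
    finally show ?thesis .
  qed
  have rot: "trace (a ** A ** b ** c) = trace (A ** b ** c ** a)"
            "trace (a ** b ** A ** c) = trace (A ** c ** a ** b)" for a b c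
    using trace_mul_sym[of a "A ** b ** c"] trace_mul_sym[of "a ** b" "A ** c"]
    by (simp_all add: matrix_mul_assoc)
  have "2 * gW A (Chr A X Y) Z = - (trace (z ** x ** A ** y) + trace (z ** y ** A ** x))"
    using assms by (simp add: gW_eq_half_trace Chr_Sym)
      (simp add: Chr_def xyz mat_simps tr_simps)
  also have "\<dots> = - trace (A ** y ** z ** x) - trace (A ** x ** z ** y)"
    by (simp add: rot)
  also have "\<dots> = trace (Z ** y ** x) - trace (X ** z ** y) - trace (Y ** z ** x)"
    unfolding syl
    using flip[of x y z] flip[of x z y] flip[of y x z] sym
    by (simp add: mat_simps tr_simps rot)
  finally show ?thesis unfolding xyz .
qed

lemma levi_civita_metric:
  assumes lc: "levi_civita nabla" and V: "vector_field V"
    and A: "A \<in> SPD" and X: "X \<in> Sym" and Z: "Z \<in> Sym"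
  shows "gW A (dir_deriv V A X) Z - trace (X ** Gam A Z ** Gam A (V A)) =
    gW A (nabla (\<lambda>_. X) V A) Z + gW A (V A) (nabla (\<lambda>_. X) (\<lambda>_. Z) A)"
proof -
  have "gW_compatible nabla"
    using lc by (simp add: levi_civita_def)
  from this[unfolded gW_compatible_def, rule_format, OF vector_field_const[OF X] V vector_field_const[OF Z] A]
  show ?thesis by (simp only: dir_deriv_gW[OF V A X Z])
qed

lemma levi_civita_vector_field:
  "levi_civita nabla \<Longrightarrow> vector_field U \<Longrightarrow> vector_field V \<Longrightarrow> vector_field (nabla U V)"
  by (simp add: levi_civita_def affine_connection_def)

lemma levi_civita_Sym:
  "levi_civita nabla \<Longrightarrow> vector_field U \<Longrightarrow> vector_field V \<Longrightarrow> A \<in> SPD \<Longrightarrow> nabla U V A \<in> Sym"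
  using levi_civita_vector_field unfolding vector_field_def by blast

lemma dir_deriv_const: "dir_deriv (\<lambda>_. Z) A H = 0"
  by (simp add: dir_deriv_def)

lemma lie_bracket_const: "lie_bracket (\<lambda>_. X) (\<lambda>_. Y) = (\<lambda>_. 0)"
  by (simp add: lie_bracket_def dir_deriv_const fun_eq_iff)

text \<open>Koszul's formula: for constant fields all Lie brackets vanish.\<close>

lemma levi_civita_const:
  fixes A X Y :: "real^'n^'n"
  assumes lc: "levi_civita nabla" and A: "A \<in> SPD" and X: "X \<in> Sym" and Y: "Y \<in> Sym"
  shows "nabla (\<lambda>_. X) (\<lambda>_. Y) A = Chr A X Y"
proof -
  let ?N = "\<lambda>P Q. nabla (\<lambda>_. P) (\<lambda>_. Q) A"
  have N_Sym: "?N P Q \<in> Sym" if "P \<in> Sym" "Q \<in> Sym" for P Q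
    by (rule levi_civita_Sym[OF lc vector_field_const vector_field_const A]) (fact that)+
  have metric: "- trace (P ** Gam A R ** Gam A Q) = gW A (?N P Q) R + gW A (?N P R) Q"
    if "P \<in> Sym" "Q \<in> Sym" "R \<in> Sym" for P Q R
  proof -
    have "gW A 0 R = 0"
      using gW_diff_left[OF A, of 0 0 R] by simp
    then show ?thesis
      using levi_civita_metric[OF lc vector_field_const[OF that(2)] A that(1,3)]
        gW_commute[OF A that(2) N_Sym[OF that(1,3)]] by (simp add: dir_deriv_const)
  qed
  have torsion: "?N P Q = ?N Q P" if "P \<in> Sym" "Q \<in> Sym" for P Q
  proof -
    have "torsion_free nabla"
      using lc by (simp add: levi_civita_def)
    from this[unfolded torsion_free_def, rule_format,
        OF vector_field_const[OF that(1)] vector_field_const[OF that(2)] A]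
    show ?thesis by (simp add: lie_bracket_const)
  qed
  have "gW A (?N X Y - Chr A X Y) Z = 0" if Z: "Z \<in> Sym" for Z
  proof -
    \<comment> \<open>The first two compatibility equations minus the third, with the symmetry of
      \<open>?N\<close>, isolate the left-hand side.\<close>
    have "2 * gW A (?N X Y) Z = 2 * gW A (Chr A X Y) Z"
      using metric[OF X Y Z] metric[OF Y X Z] metric[OF Z X Y]
        torsion[OF X Y] torsion[OF X Z] torsion[OF Y Z] gW_Chr[OF A X Y Z] by simp
    then show ?thesis by (simp add: gW_diff_left[OF A])
  qed
  then have "?N X Y - Chr A X Y = 0"
    by (intro gW_nondegenerate[OF A] subspace_diff[OF subspace_Sym] N_Sym[OF X Y] Chr_Sym[OF A X Y])
  then show ?thesis by simp
qed

text \<open>Compatibility for \<open>V\<close> is compared with compatibility for the constant field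
  of value \<open>V A\<close>: the terms depending only on the value at \<open>A\<close> coincide,
  so the two covariant derivatives differ by the ordinary derivative of \<open>V\<close>.\<close>

lemma levi_civita_eq:
  fixes A X :: "real^'n^'n"
  assumes lc: "levi_civita nabla" and V: "vector_field V" and A: "A \<in> SPD" and X: "X \<in> Sym"
  shows "nabla (\<lambda>_. X) V A = dir_deriv V A X + Chr A X (V A)"
proof -
  have VA: "V A \<in> Sym" using V A by (simp add: vector_field_def)
  have "gW A (nabla (\<lambda>_. X) V A - dir_deriv V A X - Chr A X (V A)) Z = 0" if Z: "Z \<in> Sym" for Z
  proof -
    have "gW A 0 Z = 0"
      using gW_diff_left[OF A, of 0 0 Z] by simp
    then show ?thesis
      using levi_civita_metric[OF lc V A X Z] levi_civita_metric[OF lc vector_field_const[OF VA] A X Z]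
        levi_civita_const[OF lc A X VA]
      by (simp add: gW_diff_left[OF A] dir_deriv_const)
  qed
  then have "nabla (\<lambda>_. X) V A - dir_deriv V A X - Chr A X (V A) = 0"
    by (intro gW_nondegenerate[OF A] subspace_diff[OF subspace_Sym] Chr_Sym[OF A X VA]
        dir_deriv_Sym[OF V A X] levi_civita_Sym[OF lc vector_field_const[OF X] V A])
  then show ?thesis by (simp add: algebra_simps)
qed

text \<open>Follows from additivity in the direction; it removes the bracket term from the curvature
  of constant fields.\<close>

lemma levi_civita_zero:
  assumes lc: "levi_civita nabla" and V: "vector_field V" and A: "A \<in> SPD"
  shows "nabla (\<lambda>_. 0) V A = 0"
proof -
  have "vector_field (\<lambda>_. 0 :: real^'n^'n)"
    by (intro vector_field_const subspace_0 subspace_Sym)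
  then have "nabla (\<lambda>B. 0 + 0) V A = nabla (\<lambda>_. 0) V A + nabla (\<lambda>_. 0) V A"
    using lc V A unfolding levi_civita_def affine_connection_def by blast
  then show ?thesis by simp
qed

section \<open>Curvature in terms of the Christoffel symbols\<close>

lemma dir_deriv_levi_civita:
  fixes A H X Y :: "real^'n^'n"
  assumes lc: "levi_civita nabla" and A: "A \<in> SPD" and H: "H \<in> Sym" and X: "X \<in> Sym" and Y: "Y \<in> Sym"
  shows "dir_deriv (nabla (\<lambda>_. X) (\<lambda>_. Y)) A H = DChr A H X Y"
proof (rule dir_deriv_eqI[OF A H])
  show "nabla (\<lambda>_. X) (\<lambda>_. Y) B = Chr B X Y" if "B \<in> SPD" for B
    by (rule levi_civita_const[OF lc that X Y])
  show "((\<lambda>s. Chr (A + s *\<^sub>R H) X Y) has_vector_derivative DChr A H X Y) (at 0)"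
    using has_vector_derivative_Chr[OF has_vector_derivative_line[of A H]
        has_vector_derivative_const[of X] has_vector_derivative_const[of Y], of 0 UNIV]
      eventually_line_SPD[OF A H] A linear_0[OF linear_Chr[OF A, of X]] linear_0[OF linear_Chr[OF A, of Y]]
    by (simp add: Chr_commute[of A 0])
qed

lemma curvature_eq:
  assumes lc: "levi_civita nabla" and A: "A \<in> SPD" and J: "J \<in> Sym" and X: "X \<in> Sym"
  shows "curvature nabla A J X X =
    DChr A J X X + Chr A J (Chr A X X) - DChr A X J X - Chr A X (Chr A J X)"
  using assms
  by (simp add: curvature_def curvature_field_def lie_bracket_const dir_deriv_const levi_civita_zero
      levi_civita_eq levi_civita_vector_field vector_field_const dir_deriv_levi_civita levi_civita_const)

section \<open>Jacobi fields along geodesics\<close>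

text \<open>Excluding singletons makes every point of the interval a limit point of it, so that
  derivatives within it are unique.\<close>

definition nondegenerate_interval :: "real set \<Rightarrow> bool" where
  "nondegenerate_interval I \<longleftrightarrow> is_interval I \<and> (\<forall>t. I \<noteq> {t})"

lemma at_within_nondegenerate_interval:
  "nondegenerate_interval I \<Longrightarrow> t \<in> I \<Longrightarrow> at t within I \<noteq> bot"
  using connected_imp_perfect[of I t]
  by (auto simp: nondegenerate_interval_def is_interval_connected trivial_limit_within)

lemma velocity_eqI:
  assumes "nondegenerate_interval I" and "t \<in> I"
    and eq: "\<And>s. s \<in> I \<Longrightarrow> f s = g s"
    and g: "(g has_vector_derivative D) (at t within I)"
  shows "velocity I f t = D"
  unfolding velocity_def
  by (rule vector_derivative_within[OF at_within_nondegenerate_interval[OF assms(1,2)]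
        has_vector_derivative_transform[OF \<open>t \<in> I\<close> eq g]])

lemma smooth_on_interval_has_velocity:
  assumes "smooth_on_interval I f" and "t \<in> I"
  shows "(f has_vector_derivative velocity I f t) (at t within I)"
proof -
  have "(velocity I ^^ 0) f differentiable_on I"
    using assms(1) unfolding smooth_on_interval_def by blast
  then show ?thesis
    using assms(2) by (simp add: velocity_def differentiable_on_def flip: vector_derivative_works)
qed

lemma smooth_on_interval_velocity:
  assumes "smooth_on_interval I f"
  shows "smooth_on_interval I (velocity I f)"
  unfolding smooth_on_interval_def
proof
  fix k
  have "(velocity I ^^ Suc k) f differentiable_on I"
    using assms unfolding smooth_on_interval_def by blast
  then show "(velocity I ^^ k) (velocity I f) differentiable_on I"
    by (simp only: funpow_Suc_right o_apply)
qed

lemma velocity_Sym: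
  assumes I: "nondegenerate_interval I" and "smooth_on_interval I f"
    and f: "\<And>t. t \<in> I \<Longrightarrow> f t \<in> Sym" and t: "t \<in> I"
  shows "velocity I f t \<in> Sym"
  using smooth_on_interval_has_velocity[OF assms(2) t] at_within_nondegenerate_interval[OF I t]
  by (rule has_vector_derivative_Sym) (auto simp: f t eventually_at_filter)

lemma has_vector_derivative_quadratic:
  "((\<lambda>t. a + t *\<^sub>R b + t\<^sup>2 *\<^sub>R d) has_vector_derivative b + (2 * t) *\<^sub>R d) (at t within S)"
  by (auto intro!: derivative_eq_intros simp: has_real_derivative_iff_has_vector_derivative[symmetric])

text \<open>The coefficients vary in the induction because the velocity of a quadratic polynomial is
  again of this form, with square coefficient 0.\<close>

lemma smooth_on_interval_quadratic:
  fixes f :: "real \<Rightarrow> 'a::real_normed_vector"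
  assumes I: "nondegenerate_interval I" and f: "\<And>t. t \<in> I \<Longrightarrow> f t = a + t *\<^sub>R b + t\<^sup>2 *\<^sub>R d"
  shows "smooth_on_interval I f"
  unfolding smooth_on_interval_def
proof
  fix k
  show "(velocity I ^^ k) f differentiable_on I"
    using f
  proof (induction k arbitrary: f a b d)
    case 0
    show ?case unfolding differentiable_on_def
    proof
      fix t assume "t \<in> I"
      have "(f has_vector_derivative b + (2 * t) *\<^sub>R d) (at t within I)"
        by (rule has_vector_derivative_transform[OF \<open>t \<in> I\<close> 0 has_vector_derivative_quadratic])
      then show "(velocity I ^^ 0) f differentiable at t within I"
        by (simp add: differentiableI_vector)
    qed
  next
    case (Suc k)
    have "velocity I f t = b + t *\<^sub>R (2 *\<^sub>R d) + t\<^sup>2 *\<^sub>R 0" if "t \<in> I" for t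
      using velocity_eqI[OF I that Suc.prems has_vector_derivative_quadratic] by (simp add: mult.commute)
    from Suc.IH[OF this] show ?case by (simp only: funpow_Suc_right o_apply)
  qed
qed

lemma zero_derivative_constant:
  assumes "nondegenerate_interval I" and "s \<in> I" and "t \<in> I"
    and "\<And>u. u \<in> I \<Longrightarrow> (f has_vector_derivative 0) (at u within I)"
  shows "f t = f s"
  using has_vector_derivative_zero_constant[of I f] assms
  by (metis is_interval_convex nondegenerate_interval_def)

section \<open>The Jacobi equation in the global chart\<close>

lemma cov_deriv_eq:
  assumes lc: "levi_civita nabla" and "c t \<in> SPD" and "velocity I c t \<in> Sym" and "J t \<in> Sym"
  shows "cov_deriv nabla I c J t = velocity I J t + Chr (c t) (velocity I c t) (J t)"
  using assms by (simp add: cov_deriv_def levi_civita_const)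

text \<open>The Jacobi equation is the linearisation of the geodesic equation \<open>c'' + Chr c c' c' = 0\<close>.\<close>

lemma jacobi_operator_eq:
  assumes lc: "levi_civita nabla" and I: "nondegenerate_interval I"
    and geo: "geodesic nabla I c" and t: "t \<in> I"
    and J: "smooth_on_interval I J" and J_Sym: "\<And>t. t \<in> I \<Longrightarrow> J t \<in> Sym"
  defines "V \<equiv> velocity I c"
  shows "cov_deriv nabla I c (cov_deriv nabla I c J) t + curvature nabla (c t) (J t) (V t) (V t) =
    velocity I (velocity I J) t + 2 *\<^sub>R Chr (c t) (V t) (velocity I J t) + DChr (c t) (J t) (V t) (V t)"
proof -
  note smooth = smooth_on_interval_has_velocity smooth_on_interval_velocity
  have c_SPD: "c s \<in> SPD" if "s \<in> I" for s
    using geo that by (simp add: geodesic_def)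
  have c: "smooth_on_interval I c"
    using geo by (simp add: geodesic_def)
  have V: "smooth_on_interval I V"
    unfolding V_def by (rule smooth_on_interval_velocity[OF c])
  have V_Sym: "V s \<in> Sym" if "s \<in> I" for s
    unfolding V_def
    by (rule velocity_Sym[OF I c _ that]) (use c_SPD SPD_Sym in \<open>auto simp: Sym_iff\<close>)
  note J'_Sym = velocity_Sym[OF I J J_Sym]
  have D: "cov_deriv nabla I c J s = velocity I J s + Chr (c s) (V s) (J s)" if "s \<in> I" for s
    unfolding V_def using cov_deriv_eq[OF lc, of c s I J] c_SPD[OF that] J_Sym[OF that] V_Sym[OF that]
    by (simp add: V_def)
  have D_Sym: "cov_deriv nabla I c J t \<in> Sym"
    unfolding D[OF t] by (intro subspace_add[OF subspace_Sym] J'_Sym Chr_Sym c_SPD V_Sym J_Sym t)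
  have DD: "velocity I (cov_deriv nabla I c J) t = velocity I (velocity I J) t +
      (DChr (c t) (V t) (V t) (J t) + Chr (c t) (velocity I V t) (J t) + Chr (c t) (V t) (velocity I J t))"
  proof (rule velocity_eqI[OF I t D])
    have "\<forall>\<^sub>F s in at t within I. c s \<in> SPD"
      using c_SPD by (auto simp: eventually_at_filter)
    then show "((\<lambda>s. velocity I J s + Chr (c s) (V s) (J s)) has_vector_derivative
       velocity I (velocity I J) t +
      (DChr (c t) (V t) (V t) (J t) + Chr (c t) (velocity I V t) (J t) + Chr (c t) (V t) (velocity I J t)))
      (at t within I)"
      using smooth(1)[OF c t] smooth(1)[OF V t] smooth(1)[OF J t] smooth(1)[OF smooth(2)[OF J] t] c_SPD[OF t]
      unfolding V_def by (intro has_vector_derivative_add has_vector_derivative_Chr)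
  qed
  have acc: "velocity I V t = - Chr (c t) (V t) (V t)"
  proof -
    have "cov_deriv nabla I c V t = 0"
      using geo t by (simp add: geodesic_def V_def)
    then show ?thesis
      using cov_deriv_eq[OF lc, of c t I V] c_SPD[OF t] V_Sym[OF t] by (simp add: V_def eq_neg_iff_add_eq_0)
  qed
  note lin = linear_Chr[OF c_SPD[OF t]]
  have "cov_deriv nabla I c (cov_deriv nabla I c J) t =
      velocity I (cov_deriv nabla I c J) t + Chr (c t) (V t) (cov_deriv nabla I c J t)"
    unfolding V_def using cov_deriv_eq[OF lc, of c t I "cov_deriv nabla I c J"] c_SPD[OF t] D_Sym V_Sym[OF t]
    by (simp add: V_def)
  \<comment> \<open>With the acceleration substituted, the \<open>DChr\<close> term in direction
    \<open>V t\<close> and both nested \<open>Chr\<close> terms cancel against the curvature; only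
    the derivative of \<open>Chr\<close> in direction \<open>J t\<close> survives.\<close>
  also have "\<dots> + curvature nabla (c t) (J t) (V t) (V t) =
    velocity I (velocity I J) t + 2 *\<^sub>R Chr (c t) (V t) (velocity I J t) + DChr (c t) (J t) (V t) (V t)"
    unfolding DD acc D[OF t] curvature_eq[OF lc c_SPD[OF t] J_Sym[OF t] V_Sym[OF t]]
      linear_add[OF lin] Chr_commute[of "c t" "- Chr (c t) (V t) (V t)" "J t"] linear_neg[OF lin]
    using DChr_commute[of "c t" "V t" "V t" "J t"] Chr_commute[of "c t" "V t" "J t"]
    by (simp add: scaleR_2)
  finally show ?thesis .
qed

text \<open>For a variation \<open>H\<close> of the base point and \<open>K\<close> of the velocity,
  \<open>w\<close> is the resulting variation of \<open>x\<close>. It absorbs the nested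
  \<open>Gam A (H ** x + x ** H)\<close> of \<open>DChr\<close>.\<close>

lemma Chr_DChr_complete_square:
  fixes A H K X :: "real^'n^'n"
  assumes "A \<in> SPD"
  defines "x \<equiv> Gam A X"
  defines "w \<equiv> Gam A (K - H ** x - x ** H)"
  shows "2 *\<^sub>R Chr A X K + DChr A H X X = - (2 *\<^sub>R (x ** A ** w + w ** A ** x + x ** H ** x))"
proof -
  have "w = Gam A K - Gam A (H ** x + x ** H)"
    unfolding w_def by (simp add: linear_diff[OF linear_Gam[OF assms(1)], symmetric] diff_diff_eq)
  then have "Gam A K = w + Gam A (H ** x + x ** H)"
    by simp
  then show ?thesis
    unfolding Chr_def DChr_def Let_def x_def[symmetric] by (simp add: mat_simps scaleR_2)
qed

text \<open>The equation on the right is \<open>c'' = 2 x c x\<close> linearised, with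
  \<open>J\<close> the variation of \<open>c\<close> and \<open>w J\<close> that of
  \<open>x\<close>.\<close>

lemma jacobi_field_iff:
  assumes lc: "levi_civita nabla" and I: "nondegenerate_interval I" and geo: "geodesic nabla I c"
  defines "x \<equiv> \<lambda>t. Gam (c t) (velocity I c t)"
  defines "w \<equiv> \<lambda>J t. Gam (c t) (velocity I J t - J t ** x t - x t ** J t)"
  shows "jacobi_field nabla I c J \<longleftrightarrow> (\<forall>t\<in>I. J t \<in> Sym) \<and> smooth_on_interval I J \<and>
    (\<forall>t\<in>I. velocity I (velocity I J) t =
      2 *\<^sub>R (x t ** c t ** w J t + w J t ** c t ** x t + x t ** J t ** x t))"
proof -
  have "cov_deriv nabla I c (cov_deriv nabla I c J) t +
      curvature nabla (c t) (J t) (velocity I c t) (velocity I c t) = 0 \<longleftrightarrow>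
    velocity I (velocity I J) t = 2 *\<^sub>R (x t ** c t ** w J t + w J t ** c t ** x t + x t ** J t ** x t)"
    if "\<forall>t\<in>I. J t \<in> Sym" "smooth_on_interval I J" "t \<in> I" for t
  proof -
    have "c t \<in> SPD" using geo that by (simp add: geodesic_def)
    from Chr_DChr_complete_square[OF this, of "velocity I c t" "velocity I J t" "J t"]
    show ?thesis
      using jacobi_operator_eq[OF lc I geo that(3,2)] that(1)
      unfolding x_def w_def by (simp add: add.assoc)
  qed
  then show ?thesis
    unfolding jacobi_field_def by blast
qed

section \<open>Explicit form of the geodesics\<close>

lemma SPD_congruence_invertible:
  fixes A M :: "real^'n^'n"
  assumes "M ** A ** M \<in> SPD"
  obtains N where "N ** M = mat 1" "M ** N = mat 1"
proof -
  have "v = 0" if "M *v v = 0" for v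
  proof (rule ccontr)
    assume "v \<noteq> 0"
    then have "v \<bullet> ((M ** A ** M) *v v) > 0"
      using assms by (simp add: SPD_def)
    then show False
      using that by (simp flip: matrix_vector_mul_assoc)
  qed
  then show ?thesis
    using matrix_left_invertible_ker[of M] matrix_left_right_inverse that by blast
qed

text \<open>In a word bracketed to the left, \<open>a ** b\<close> is not a subterm once
  \<open>p\<close> precedes it; this form allows the cancellation there.\<close>

lemma matrix_mul_eq_extend:
  fixes a b c p :: "real^'n^'n"
  assumes "a ** b = c" shows "p ** a ** b = p ** c"
  using assms by (simp flip: matrix_mul_assoc)

lemma geodesic_Gam_velocity_derivative:
  assumes lc: "levi_civita nabla" and I: "nondegenerate_interval I"
    and geo: "geodesic nabla I c" and t: "t \<in> I"
  defines "x \<equiv> \<lambda>t. Gam (c t) (velocity I c t)"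
  shows "(velocity I c has_vector_derivative 2 *\<^sub>R (x t ** c t ** x t)) (at t within I)"
    and "(x has_vector_derivative - (x t ** x t)) (at t within I)"
proof -
  have c_SPD: "c s \<in> SPD" if "s \<in> I" for s
    using geo that by (simp add: geodesic_def)
  have c: "smooth_on_interval I c"
    using geo by (simp add: geodesic_def)
  have "velocity I c t \<in> Sym"
    by (rule velocity_Sym[OF I c _ t]) (use c_SPD SPD_Sym in \<open>auto simp: Sym_iff\<close>)
  then have "velocity I (velocity I c) t = - Chr (c t) (velocity I c t) (velocity I c t)"
    using geo t c_SPD[OF t] cov_deriv_eq[OF lc, of c t I "velocity I c"]
    by (simp add: geodesic_def eq_neg_iff_add_eq_0)
  then have acc: "velocity I (velocity I c) t = 2 *\<^sub>R (x t ** c t ** x t)"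
    by (simp add: Chr_def x_def scaleR_2)
  show V: "(velocity I c has_vector_derivative 2 *\<^sub>R (x t ** c t ** x t)) (at t within I)"
    using smooth_on_interval_has_velocity[OF smooth_on_interval_velocity[OF c] t] acc by simp
  have syl: "velocity I c t = c t ** x t + x t ** c t"
    using c_SPD[OF t] by (simp add: x_def Gam_eq)
  have "\<forall>\<^sub>F s in at t within I. c s \<in> SPD"
    using c_SPD by (auto simp: eventually_at_filter)
  from has_vector_derivative_Gam[OF smooth_on_interval_has_velocity[OF c t] V c_SPD[OF t] this]
  have "(x has_vector_derivative Gam (c t) (2 *\<^sub>R (x t ** c t ** x t) - velocity I c t ** x t
      - x t ** velocity I c t)) (at t within I)"
    by (simp add: x_def)
  \<comment> \<open>Inserting \<open>c' = c x + x c\<close>, the argument collapses to the Sylvester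
    image of \<open>- (x t ** x t)\<close>.\<close>
  moreover have "Gam (c t) (2 *\<^sub>R (x t ** c t ** x t) - velocity I c t ** x t - x t ** velocity I c t) =
      - (x t ** x t)"
    by (rule Gam_unique[OF c_SPD[OF t]]) (simp add: syl mat_simps scaleR_2)
  ultimately show "(x has_vector_derivative - (x t ** x t)) (at t within I)"
    by simp
qed

text \<open>\<open>x c x\<close> is constant along the geodesic, hence so is the acceleration.\<close>

lemma geodesic_explicit:
  assumes lc: "levi_civita nabla" and I: "nondegenerate_interval I" and "0 \<in> I"
    and geo: "geodesic nabla I c" and t: "t \<in> I"
  defines "x \<equiv> \<lambda>t. Gam (c t) (velocity I c t)"
  defines "M \<equiv> mat 1 + t *\<^sub>R x 0" and "N \<equiv> mat 1 - t *\<^sub>R x t"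
  shows "c t = M ** c 0 ** M" "N ** M = mat 1" "M ** N = mat 1" "M ** x t = x 0" "x t ** M = x 0"
proof -
  have d: "(velocity I c has_vector_derivative 2 *\<^sub>R (x s ** c s ** x s)) (at s within I)"
    "(x has_vector_derivative - (x s ** x s)) (at s within I)" if "s \<in> I" for s
    using geodesic_Gam_velocity_derivative[OF lc I geo that] unfolding x_def by simp_all
  have c_SPD: "c s \<in> SPD" if "s \<in> I" for s
    using geo that by (simp add: geodesic_def)
  have syl: "c s ** x s + x s ** c s = velocity I c s" if "s \<in> I" for s
    using c_SPD[OF that] by (simp add: x_def Gam_eq)
  have c: "(c has_vector_derivative velocity I c s) (at s within I)" if "s \<in> I" for s
    using geo that by (simp add: geodesic_def smooth_on_interval_has_velocity)
  define P where "P = x 0 ** c 0 ** x 0"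
  have P: "x s ** c s ** x s = P" if "s \<in> I" for s
    unfolding P_def
  proof (rule zero_derivative_constant[OF I \<open>0 \<in> I\<close> that])
    fix u assume u: "u \<in> I"
    show "((\<lambda>s. x s ** c s ** x s) has_vector_derivative 0) (at u within I)"
      by (rule has_vector_derivative_eq_rhs,
          rule matmul.has_vector_derivative[OF matmul.has_vector_derivative[OF d(2)[OF u] c[OF u]] d(2)[OF u]])
        (simp add: syl[OF u, symmetric] mat_simps)
  qed
  have V: "velocity I c s - (2 * s) *\<^sub>R P = velocity I c 0 - (2 * 0) *\<^sub>R P" if "s \<in> I" for s
  proof (rule zero_derivative_constant[OF I \<open>0 \<in> I\<close> that])
    fix u assume u: "u \<in> I"
    have "((\<lambda>s. (2 * s) *\<^sub>R P) has_vector_derivative 2 *\<^sub>R P) (at u within I)"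
      by (auto intro!: derivative_eq_intros)
    from has_vector_derivative_diff[OF d(1)[OF u] this]
    show "((\<lambda>s. velocity I c s - (2 * s) *\<^sub>R P) has_vector_derivative 0) (at u within I)"
      by (simp add: P[OF u])
  qed
  \<comment> \<open>The velocity is affine with slope \<open>2 *\<^sub>R P\<close>; a second
    integration gives a quadratic, which factors as \<open>M ** c 0 ** M\<close> because
    \<open>P\<close> is \<open>x 0 ** c 0 ** x 0\<close>.\<close>
  have "c t - (0 + t *\<^sub>R velocity I c 0 + t\<^sup>2 *\<^sub>R P) = c 0 - (0 + 0 *\<^sub>R velocity I c 0 + 0\<^sup>2 *\<^sub>R P)"
  proof (rule zero_derivative_constant[OF I \<open>0 \<in> I\<close> t])
    fix u assume u: "u \<in> I"
    show "((\<lambda>t. c t - (0 + t *\<^sub>R velocity I c 0 + t\<^sup>2 *\<^sub>R P)) has_vector_derivative 0) (at u within I)"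
      by (rule has_vector_derivative_eq_rhs,
          rule has_vector_derivative_diff[OF c[OF u] has_vector_derivative_quadratic])
        (use V[OF u] in \<open>simp add: algebra_simps\<close>)
  qed
  then show ct: "c t = M ** c 0 ** M"
    unfolding M_def P_def syl[OF \<open>0 \<in> I\<close>, symmetric]
    by (simp add: mat_simps power2_eq_square algebra_simps)
  then obtain N' where N': "N' ** M = mat 1" "M ** N' = mat 1"
    using SPD_congruence_invertible c_SPD[OF t] by metis
  have comm: "M ** x 0 = x 0 ** M"
    by (simp add: M_def mat_simps)
  have comm': "N' ** x 0 = x 0 ** N'"
    using arg_cong[OF comm, of "\<lambda>B. N' ** B ** N'"] N'
    by (simp add: matrix_mul_assoc matrix_mul_eq_extend[OF N'(2)])
  \<comment> \<open>Checking the Sylvester equation for the candidate \<open>N' ** x 0\<close>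
    identifies it with \<open>x t\<close>.\<close>
  have "c t ** (N' ** x 0) + (N' ** x 0) ** c t = velocity I c t"
  proof -
    have "c t ** (N' ** x 0) = M ** c 0 ** x 0"
      unfolding ct by (simp add: matrix_mul_assoc matrix_mul_eq_extend[OF N'(2)])
    moreover have "(N' ** x 0) ** c t = x 0 ** c 0 ** M"
      unfolding ct comm' by (simp add: matrix_mul_assoc matrix_mul_eq_extend[OF N'(1)])
    moreover have "velocity I c t = velocity I c 0 + (2 * t) *\<^sub>R P"
      using V[OF t] by (simp add: algebra_simps)
    ultimately show ?thesis
      unfolding M_def P_def syl[OF \<open>0 \<in> I\<close>, symmetric] by (simp add: mat_simps algebra_simps flip: scaleR_add_left)
  qed
  from Gam_unique[OF c_SPD[OF t] this] have xt: "x t = N' ** x 0"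
    by (simp only: x_def)
  show "M ** x t = x 0"
    unfolding xt by (simp add: matrix_mul_assoc N')
  show "x t ** M = x 0"
    unfolding xt comm' by (simp add: N' flip: matrix_mul_assoc)
  \<comment> \<open>Expanding \<open>N' ** M = mat 1\<close> gives
    \<open>N' = mat 1 - t *\<^sub>R (N' ** x 0)\<close>, and the last product is
    \<open>x t\<close>.\<close>
  have "N' = N"
    using N'(1) unfolding N_def xt by (simp add: M_def mat_simps algebra_simps)
  then show "N ** M = mat 1" "M ** N = mat 1"
    using N' by simp_all
qed

text \<open>The linearisations of \<open>c = M A M\<close>, \<open>c' = c x + x c\<close> and \<open>c'' = 2 x c x\<close> at \<open>y\<close> in the
  direction \<open>w = N y N\<close>.\<close>

lemma linearised_geodesic:
  fixes A y x\<^sub>0 x :: "real^'n^'n" and t :: real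
  defines "M \<equiv> mat 1 + t *\<^sub>R x\<^sub>0" and "N \<equiv> mat 1 - t *\<^sub>R x"
  assumes inv: "N ** M = mat 1" "M ** N = mat 1" and x: "M ** x = x\<^sub>0" "x ** M = x\<^sub>0"
  defines "c \<equiv> M ** A ** M" and "w \<equiv> N ** y ** N" and "Q \<equiv> x\<^sub>0 ** A ** y + y ** A ** x\<^sub>0"
  defines "J \<equiv> t *\<^sub>R (M ** A ** y + y ** A ** M)"
  shows "J = t *\<^sub>R (A ** y + y ** A) + t\<^sup>2 *\<^sub>R Q"
    and "c ** w + w ** c = A ** y + y ** A + (2 * t) *\<^sub>R Q - J ** x - x ** J"
    and "Q = x ** c ** w + w ** c ** x + x ** J ** x"
proof -
  note ext = matrix_mul_eq_extend[OF inv(1)] matrix_mul_eq_extend[OF inv(2)]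
    matrix_mul_eq_extend[OF x(1)] matrix_mul_eq_extend[OF x(2)]
  show "J = t *\<^sub>R (A ** y + y ** A) + t\<^sup>2 *\<^sub>R Q"
    unfolding J_def Q_def M_def by (simp add: mat_simps power2_eq_square scaleR_add_right)
  have cw: "c ** w = M ** A ** y ** N" and wc: "w ** c = N ** y ** A ** M"
    unfolding c_def w_def by (simp_all add: matrix_mul_assoc ext)
  have Jx: "J ** x = t *\<^sub>R (M ** A ** y ** x + y ** A ** x\<^sub>0)"
    and xJ: "x ** J = t *\<^sub>R (x\<^sub>0 ** A ** y + x ** y ** A ** M)"
    unfolding J_def by (simp_all add: mat_simps ext x)
  have cw': "c ** w = M ** A ** y - t *\<^sub>R (M ** A ** y ** x)"
    and wc': "w ** c = y ** A ** M - t *\<^sub>R (x ** y ** A ** M)"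
    unfolding cw wc N_def by (simp_all add: mat_simps)
  have MQ: "M ** A ** y + y ** A ** M = A ** y + y ** A + t *\<^sub>R Q"
    unfolding M_def Q_def by (simp add: mat_simps scaleR_add_right)
  have "(2 * t) *\<^sub>R Q = t *\<^sub>R Q + t *\<^sub>R Q"
    by (simp flip: scaleR_add_left)
  then show "c ** w + w ** c = A ** y + y ** A + (2 * t) *\<^sub>R Q - J ** x - x ** J"
    using MQ unfolding cw' wc' Jx xJ by (simp add: Q_def algebra_simps)
  have "x ** c ** w = x\<^sub>0 ** A ** y ** N"
    using arg_cong[OF cw, of "\<lambda>B. x ** B"] by (simp add: matrix_mul_assoc x)
  moreover have "w ** c ** x = N ** y ** A ** x\<^sub>0"
    unfolding wc by (rule ext(3))
  moreover have "x ** J ** x = t *\<^sub>R (x\<^sub>0 ** A ** y ** x + x ** y ** A ** x\<^sub>0)"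
    unfolding xJ by (simp add: mat_simps ext)
  ultimately show "Q = x ** c ** w + w ** c ** x + x ** J ** x"
    unfolding N_def Q_def by (simp add: mat_simps scaleR_add_right)
qed

text \<open>Reduces the Jacobi equation to a first-order linear equation whose inhomogeneity
  \<open>w\<close> depends only on the geodesic and \<open>Y\<close>, hence is shared by all
  solutions with these initial data.\<close>

lemma jacobi_field_linearised_Gam:
  assumes lc: "levi_civita nabla" and I: "nondegenerate_interval I" and I0: "0 \<in> I"
    and geo: "geodesic nabla I c" and K: "jacobi_field nabla I c K"
    and K0: "K 0 = 0" and covK0: "cov_deriv nabla I c K 0 = Y" and t: "t \<in> I"
  defines "x \<equiv> \<lambda>t. Gam (c t) (velocity I c t)"
  defines "N \<equiv> mat 1 - t *\<^sub>R x t"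
  defines "w \<equiv> N ** Gam (c 0) Y ** N"
  shows "velocity I K t = K t ** x t + x t ** K t + c t ** w + w ** c t"
proof -
  define v where "v s = Gam (c s) (velocity I K s - K s ** x s - x s ** K s)" for s
  have c_SPD: "c s \<in> SPD" if "s \<in> I" for s
    using geo that by (simp add: geodesic_def)
  have c: "smooth_on_interval I c"
    using geo by (simp add: geodesic_def)
  have K_smooth: "smooth_on_interval I K" and K_Sym: "K s \<in> Sym"
    and K'': "velocity I (velocity I K) s = 2 *\<^sub>R (x s ** c s ** v s + v s ** c s ** x s + x s ** K s ** x s)"
    if "s \<in> I" for s
    using K that unfolding jacobi_field_iff[OF lc I geo] v_def x_def by blast+
  have dx: "(x has_vector_derivative - (x s ** x s)) (at s within I)" if "s \<in> I" for s
    using geodesic_Gam_velocity_derivative(2)[OF lc I geo that] unfolding x_def by simp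
  have syl_x: "velocity I c s = c s ** x s + x s ** c s" if "s \<in> I" for s
    using c_SPD[OF that] by (simp add: x_def Gam_eq)
  have syl_v: "velocity I K s = K s ** x s + x s ** K s + c s ** v s + v s ** c s" if "s \<in> I" for s
    using Gam_eq[OF c_SPD[OF that], of "velocity I K s - K s ** x s - x s ** K s"]
    unfolding v_def by (simp add: algebra_simps)
  have dv: "(v has_vector_derivative - (v s ** x s + x s ** v s)) (at s within I)" if s: "s \<in> I" for s
  proof -
    note dK = smooth_on_interval_has_velocity[OF K_smooth[OF s] s]
      and dK' = smooth_on_interval_has_velocity[OF smooth_on_interval_velocity[OF K_smooth[OF s]] s]
    have "\<forall>\<^sub>F s in at s within I. c s \<in> SPD"
      using c_SPD by (auto simp: eventually_at_filter)
    from has_vector_derivative_Gam[OF smooth_on_interval_has_velocity[OF c s]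
        has_vector_derivative_diff[OF has_vector_derivative_diff[OF dK'
          matmul.has_vector_derivative[OF dK dx[OF s]]] matmul.has_vector_derivative[OF dx[OF s] dK]]
        c_SPD[OF s] this]
    have "(v has_vector_derivative Gam (c s) (velocity I (velocity I K) s
        - (K s ** - (x s ** x s) + velocity I K s ** x s)
        - (x s ** velocity I K s + - (x s ** x s) ** K s)
        - velocity I c s ** v s - v s ** velocity I c s)) (at s within I)"
      unfolding v_def[symmetric] v_def[symmetric, abs_def] .
    \<comment> \<open>The Jacobi equation and the Sylvester equations for \<open>x\<close> and
      \<open>v\<close> turn the argument into the Sylvester image of the right-hand side.\<close>
    moreover have "Gam (c s) (velocity I (velocity I K) s
        - (K s ** - (x s ** x s) + velocity I K s ** x s)
        - (x s ** velocity I K s + - (x s ** x s) ** K s)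
        - velocity I c s ** v s - v s ** velocity I c s) = - (v s ** x s + x s ** v s)"
      unfolding K''[OF s] syl_v[OF s] syl_x[OF s]
      by (rule Gam_unique[OF c_SPD[OF s]]) (simp add: mat_simps scaleR_2)
    ultimately show ?thesis by simp
  qed
  define M where "M s = mat 1 + s *\<^sub>R x 0" for s
  have Mx: "M s ** x s = x 0" "x s ** M s = x 0" if "s \<in> I" for s
    using geodesic_explicit(4,5)[OF lc I I0 geo that] unfolding x_def M_def by simp_all
  have dM: "(M has_vector_derivative x 0) (at s within I)" for s
    unfolding M_def[abs_def] by (auto intro!: derivative_eq_intros)
  \<comment> \<open>The derivative \<open>x 0\<close> of \<open>M\<close> equals both
    \<open>M s ** x s\<close> and \<open>x s ** M s\<close>, which cancels the two terms of the
    derivative of \<open>v\<close>.\<close>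
  have "M t ** v t ** M t = M 0 ** v 0 ** M 0"
  proof (rule zero_derivative_constant[OF I I0 t])
    fix s assume s: "s \<in> I"
    show "((\<lambda>s. M s ** v s ** M s) has_vector_derivative 0) (at s within I)"
      by (rule has_vector_derivative_eq_rhs,
          rule matmul.has_vector_derivative[OF matmul.has_vector_derivative[OF dM dv[OF s]] dM])
        (simp add: mat_simps Mx[OF s] matrix_mul_eq_extend[OF Mx(2)[OF s]])
  qed
  \<comment> \<open>Since \<open>K 0 = 0\<close>, the Christoffel term vanishes at 0 and the initial
    covariant derivative is the ordinary one.\<close>
  also have "\<dots> = Gam (c 0) Y"
  proof -
    have "velocity I c 0 \<in> Sym"
      by (rule velocity_Sym[OF I c _ I0]) (use c_SPD SPD_Sym in \<open>auto simp: Sym_iff\<close>)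
    then have "Y = velocity I K 0 + Chr (c 0) (velocity I c 0) 0"
      using cov_deriv_eq[OF lc, of c 0 I K] c_SPD[OF I0] K_Sym[OF I0] K0 covK0 by simp
    then have "velocity I K 0 = Y"
      by (simp add: linear_0[OF linear_Chr[OF c_SPD[OF I0]]])
    then show ?thesis
      by (simp add: M_def v_def K0)
  qed
  finally have "w = N ** (M t ** v t ** M t) ** N"
    by (simp only: w_def)
  then have "w = (N ** M t) ** v t ** (M t ** N)"
    by (simp only: matrix_mul_assoc)
  moreover have "N ** M t = mat 1" "M t ** N = mat 1"
    using geodesic_explicit(2,3)[OF lc I I0 geo t] unfolding x_def M_def N_def by simp_all
  ultimately have "w = v t"
    by simp
  then show ?thesis
    using syl_v[OF t] by simp
qed

text \<open>\<open>N\<close> satisfies \<open>N' = - x N = - N x\<close>, so multiplying by it on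
  both sides is an explicit integrating factor for \<open>D' = D x + x D\<close>, where
  \<open>D\<close> is the difference of the solutions.\<close>

lemma jacobi_field_unique:
  assumes lc: "levi_civita nabla" and I: "nondegenerate_interval I" and I0: "0 \<in> I"
    and geo: "geodesic nabla I c" and t: "t \<in> I"
    and J: "jacobi_field nabla I c J" "J 0 = 0" "cov_deriv nabla I c J 0 = Y"
    and K: "jacobi_field nabla I c K" "K 0 = 0" "cov_deriv nabla I c K 0 = Y"
  shows "K t = J t"
proof -
  define x where "x s = Gam (c s) (velocity I c s)" for s
  define N where "N s = mat 1 - s *\<^sub>R x s" for s
  define M where "M = mat 1 + t *\<^sub>R x 0"
  have comm: "N s ** x s = x s ** N s" for s
    by (simp add: N_def mat_simps)
  have dN: "(N has_vector_derivative - (x s ** N s)) (at s within I)" if s: "s \<in> I" for s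
  proof -
    have "(x has_vector_derivative - (x s ** x s)) (at s within I)"
      using geodesic_Gam_velocity_derivative(2)[OF lc I geo s] unfolding x_def[abs_def] by simp
    then show ?thesis
      unfolding N_def[abs_def]
      by (auto intro!: derivative_eq_intros
          simp: mat_simps has_real_derivative_iff_has_vector_derivative[symmetric])
  qed
  have dD: "((\<lambda>s. K s - J s) has_vector_derivative (K s - J s) ** x s + x s ** (K s - J s)) (at s within I)"
    if s: "s \<in> I" for s
  proof -
    have "(K has_vector_derivative velocity I K s) (at s within I)"
      and "(J has_vector_derivative velocity I J s) (at s within I)"
      using J(1) K(1) s by (simp_all add: jacobi_field_def smooth_on_interval_has_velocity)
    from has_vector_derivative_diff[OF this] show ?thesis
      unfolding jacobi_field_linearised_Gam[OF lc I I0 geo J s]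
        jacobi_field_linearised_Gam[OF lc I I0 geo K s] x_def[symmetric]
      by (simp add: matmul.diff_left matmul.diff_right algebra_simps)
  qed
  have "N t ** (K t - J t) ** N t = N 0 ** (K 0 - J 0) ** N 0"
  proof (rule zero_derivative_constant[OF I I0 t])
    fix s assume s: "s \<in> I"
    have "- (x s ** N s) ** (K s - J s) = - (N s ** x s) ** (K s - J s)"
      by (simp only: comm)
    with matmul.has_vector_derivative[OF dN[OF s] dD[OF s]]
    have "((\<lambda>s. N s ** (K s - J s)) has_vector_derivative N s ** (K s - J s) ** x s) (at s within I)"
      by (simp add: matmul.add_right matmul.minus_left matrix_mul_assoc)
    from matmul.has_vector_derivative[OF this dN[OF s]]
    show "((\<lambda>s. N s ** (K s - J s) ** N s) has_vector_derivative 0) (at s within I)"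
      by (simp add: matmul.minus_right matrix_mul_assoc)
  qed
  \<comment> \<open>Multiplying by \<open>M\<close>, the inverse of \<open>N t\<close>, removes the
    integrating factor.\<close>
  then have "(M ** N t) ** (K t - J t) ** (N t ** M) = 0"
    using J(2) K(2) by (metis matrix_mul_assoc diff_self times0_left times0_right)
  then show ?thesis
    using geodesic_explicit(2,3)[OF lc I I0 geo t] by (simp add: M_def N_def x_def)
qed

section \<open>Existence, normality and the closed formula\<close>

theorem theorem5p1:
  fixes nabla :: "'n::finite connection"
    and I :: "real set"
    and \<gamma> :: "real \<Rightarrow> real^'n^'n"
    and A X Y :: "real^'n^'n"
  assumes "levi_civita nabla"
    and "is_interval I" and "0 \<in> I" and "I \<noteq> {0}"
    and "geodesic nabla I \<gamma>"
    and "A \<in> SPD" and "\<gamma> 0 = A"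
    and "X \<in> Sym" and "velocity I \<gamma> 0 = X"
    and "Y \<in> Sym" and "gW A X Y = 0"
  shows "\<exists>J. normal_jacobi_field nabla I \<gamma> J \<and> J 0 = 0 \<and> cov_deriv nabla I \<gamma> J 0 = Y \<and>
           (\<forall>J'. normal_jacobi_field nabla I \<gamma> J' \<and> J' 0 = 0 \<and> cov_deriv nabla I \<gamma> J' 0 = Y \<longrightarrow>
              (\<forall>t\<in>I. J' t = J t)) \<and>
           (\<forall>t\<in>I. J t = t *\<^sub>R Y + (t\<^sup>2) *\<^sub>R (Gam A X ** A ** Gam A Y + Gam A Y ** A ** Gam A X))"
proof -
  note lc = assms(1) and I0 = assms(3) and geo = assms(5) and A = assms(6) and X = assms(8) and Y = assms(10)
  have I: "nondegenerate_interval I"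
    using assms(2-4) by (auto simp: nondegenerate_interval_def)
  define x where "x t = Gam (\<gamma> t) (velocity I \<gamma> t)" for t
  define y where "y = Gam A Y"
  define Q where "Q = x 0 ** A ** y + y ** A ** x 0"
  define J where "J t = t *\<^sub>R Y + t\<^sup>2 *\<^sub>R Q" for t
  define M N where "M t = mat 1 + t *\<^sub>R x 0" and "N t = mat 1 - t *\<^sub>R x t" for t
  \<comment> \<open>As a negative Christoffel symbol, \<open>Q\<close> is a symmetric matrix by
    \<open>Chr_Sym\<close>.\<close>
  have x0: "x 0 = Gam A X" and Q: "Q = - Chr A X Y"
    using assms(7,9) by (simp_all add: x_def Q_def y_def Chr_def)
  have Y_eq: "Y = A ** y + y ** A"
    using Gam_eq[OF A] by (simp add: y_def)
  have J_Sym: "J t \<in> Sym" for t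
    unfolding J_def Q
    by (intro subspace_add subspace_scale subspace_neg subspace_Sym Chr_Sym A X Y)
  have J_quadratic: "J t = 0 + t *\<^sub>R Y + t\<^sup>2 *\<^sub>R Q" for t
    by (simp add: J_def)
  have J': "velocity I J t = Y + (2 * t) *\<^sub>R Q" if "t \<in> I" for t
    by (rule velocity_eqI[OF I that J_quadratic has_vector_derivative_quadratic])
  have J'': "velocity I (velocity I J) t = 2 *\<^sub>R Q" if "t \<in> I" for t
    by (rule velocity_eqI[OF I that J']) (auto intro!: derivative_eq_intros)
  have explicit: "\<gamma> t = M t ** A ** M t" "N t ** M t = mat 1" "M t ** N t = mat 1"
    "M t ** x t = x 0" "x t ** M t = x 0" if "t \<in> I" for t
    using geodesic_explicit[OF lc I I0 geo that] assms(7) unfolding x_def M_def N_def by simp_all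
  \<comment> \<open>The factored form shows \<open>J\<close> as the variation of
    \<open>M A M\<close> when \<open>x 0\<close> moves in direction \<open>y\<close>; the other two
    identities show that \<open>N y N\<close> is the matching variation of \<open>x\<close>.\<close>
  have J_eq: "J t = t *\<^sub>R (M t ** A ** y + y ** A ** M t)"
    and first: "\<gamma> t ** (N t ** y ** N t) + N t ** y ** N t ** \<gamma> t = Y + (2 * t) *\<^sub>R Q - J t ** x t - x t ** J t"
    and second: "Q = x t ** \<gamma> t ** (N t ** y ** N t) + N t ** y ** N t ** \<gamma> t ** x t + x t ** J t ** x t"
    if t: "t \<in> I" for t
  proof -
    note linearised = linearised_geodesic[where A = A and y = y and x = "x t" and x\<^sub>0 = "x 0" and t = t,
        folded M_def N_def, OF explicit(2-5)[OF t], folded Q_def Y_eq, folded explicit(1)[OF t]]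
    show J: "J t = t *\<^sub>R (M t ** A ** y + y ** A ** M t)"
      using linearised(1) by (simp add: J_def)
    show "\<gamma> t ** (N t ** y ** N t) + N t ** y ** N t ** \<gamma> t = Y + (2 * t) *\<^sub>R Q - J t ** x t - x t ** J t"
      using linearised(2) unfolding J[symmetric] .
    show "Q = x t ** \<gamma> t ** (N t ** y ** N t) + N t ** y ** N t ** \<gamma> t ** x t + x t ** J t ** x t"
      using linearised(3) unfolding J[symmetric] .
  qed
  have w: "Gam (\<gamma> t) (velocity I J t - J t ** x t - x t ** J t) = N t ** y ** N t" if t: "t \<in> I" for t
  proof (rule Gam_unique)
    show "\<gamma> t \<in> SPD" using geo t by (simp add: geodesic_def)
    show "\<gamma> t ** (N t ** y ** N t) + N t ** y ** N t ** \<gamma> t = velocity I J t - J t ** x t - x t ** J t"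
      using first[OF t] by (simp only: J'[OF t])
  qed
  have jacobi: "jacobi_field nabla I \<gamma> J"
    unfolding jacobi_field_iff[OF lc I geo] x_def[symmetric]
  proof (intro conjI ballI J_Sym smooth_on_interval_quadratic[OF I J_quadratic])
    fix t assume t: "t \<in> I"
    show "velocity I (velocity I J) t = 2 *\<^sub>R (x t ** \<gamma> t ** Gam (\<gamma> t) (velocity I J t - J t ** x t - x t ** J t) +
      Gam (\<gamma> t) (velocity I J t - J t ** x t - x t ** J t) ** \<gamma> t ** x t + x t ** J t ** x t)"
      unfolding J''[OF t] w[OF t] second[OF t, symmetric] ..
  qed
  have "gW (\<gamma> t) (J t) (velocity I \<gamma> t) = 0" if t: "t \<in> I" for t
  proof -
    \<comment> \<open>Up to the factor 1/2 this is the inner product with the velocity. In the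
      factored form of \<open>J\<close>, the rules \<open>x M = M x = x 0\<close> reduce both traces
      to the inner product of \<open>X\<close> and \<open>Y\<close> at \<open>A\<close>, which is
      zero.\<close>
    have "trace (x t ** J t) = t * (trace (x 0 ** A ** y) + trace (x t ** y ** A ** M t))"
      by (simp add: J_eq[OF t] mat_simps tr_simps explicit(5)[OF t])
    also have "trace (x t ** y ** A ** M t) = trace (x 0 ** y ** A)"
      using trace_mul_sym[of "x t ** y ** A" "M t"] by (simp add: matrix_mul_assoc explicit(4)[OF t])
    also have "\<dots> = trace (y ** A ** x 0)"
      using trace_mul_sym[of "x 0" "y ** A"] by (simp add: matrix_mul_assoc)
    also have "\<dots> = 0"
      using assms(11) by (simp add: gW_def x0 y_def)
    also have "trace (x 0 ** A ** y) = 0"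
      using assms(11) gW_commute[OF A X Y] by (simp add: gW_def x0 y_def)
    finally have "trace (x t ** J t) = 0" by simp
    moreover have "\<gamma> t \<in> SPD" "velocity I \<gamma> t \<in> Sym"
      using geo t velocity_Sym[OF I, of \<gamma>] SPD_Sym by (auto simp: geodesic_def Sym_iff)
    ultimately show ?thesis
      using J_Sym by (simp add: gW_eq_half_trace x_def)
  qed
  with jacobi have normal: "normal_jacobi_field nabla I \<gamma> J"
    by (simp add: normal_jacobi_field_def)
  have J0: "J 0 = 0"
    by (simp add: J_def)
  have cov: "cov_deriv nabla I \<gamma> J 0 = Y"
    using cov_deriv_eq[OF lc, of \<gamma> 0 I J] A X J_Sym[of 0] assms(7,9) J'[OF I0]
    by (simp add: J0 linear_0[OF linear_Chr[OF A]])
  show ?thesis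
  proof (intro exI[of _ J] conjI allI impI ballI normal J0 cov)
    fix J' t
    assume "normal_jacobi_field nabla I \<gamma> J' \<and> J' 0 = 0 \<and> cov_deriv nabla I \<gamma> J' 0 = Y" and "t \<in> I"
    then show "J' t = J t"
      using jacobi_field_unique[OF lc I I0 geo _ jacobi J0 cov] by (simp add: normal_jacobi_field_def)
  next
    show "J t = t *\<^sub>R Y + t\<^sup>2 *\<^sub>R (Gam A X ** A ** Gam A Y + Gam A Y ** A ** Gam A X)" for t
      by (simp add: J_def Q_def x0 y_def)
  qed
qed

end
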